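(* Let $\eta\in\{2,3,\dots\}\sqcup\{\infty\}$ and $\kappa\in\{0,1,2,\dots\}$. If for every $i\in J_\eta$, $S_i$ is a bounded unilateral classical weighted shift with positive weights $\{\alpha_{i,n}\}_{n=1}^\infty$, then the following two conditions are equivalent: (i) there exists a system $\boldsymbol\lambda=\{\lambda_v\}_{v\in V_{\eta,\kappa}^\circ}$ of positive scalars such that the weighted shift $S_{\boldsymbol\lambda}$ on the directed tree $\mathcal T_{\eta,\kappa}$ is bounded and completely hyperexpansive, and $$\alpha_{i,n}=\lambda_{i,n+1},\qquad n\in\mathbb N,\ i\in J_\eta;$$ (ii) the operator $S_i$ is completely hyperexpansive and $\int_0^1\frac1{s^{\kappa+1}}\,d\tau_i(s)<\infty$ for every $i\in J_\eta$ (where $\tau_i$ is the representing measure of $S_i$), $S_{i_0}$ has a completely hyperexpansive $(\kappa+1)$-step backward extension for some $i_0\in J_\eta$, and $\sup_{i\in J_\eta}\|S_i\|<\infty$.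
   Context: $\mathbb N=\{1,2,\dots\}$; $J_\iota=\{k\in\mathbb N:k\le\iota\}$ for $\iota\in\{0,1,2,\dots\}\sqcup\{\infty\}$ (so $J_0=\varnothing$, $J_\infty=\mathbb N$). For $\kappa<\infty$, the directed tree $\mathcal T_{\eta,\kappa}=(V_{\eta,\kappa},E_{\eta,\kappa})$ has vertex set $V_{\eta,\kappa}=\{-k:k\in J_\kappa\}\sqcup\{0\}\sqcup\{(i,j):i\in J_\eta,\ j\in\mathbb N\}$ and edge set $E_{\eta,\kappa}=\{(-k,-k+1):k\in J_\kappa\}\sqcup\{(0,(i,1)):i\in J_\eta\}\sqcup\{((i,j),(i,j+1)):i\in J_\eta,\ j\in\mathbb N\}$, an edge $(u,v)$ being directed from $u$ (the parent $\operatorname{par}(v)$ of $v$) to $v$. Its root (the vertex without parent) is $-\kappa$, and $V_{\eta,\kappa}^\circ=V_{\eta,\kappa}\setminus\{-\kappa\}$. We write $\lambda_{i,j}$ for $\lambda_{(i,j)}$. The weighted shift $S_{\boldsymbol\lambda}$ on $\mathcal T_{\eta,\kappa}$ with weights $\boldsymbol\lambda=\{\lambda_v\}_{v\in V_{\eta,\kappa}^\circ}$ is the operator in $\ell^2(V_{\eta,\kappa})$ given by $(S_{\boldsymbol\lambda}f)(v)=\lambda_vf(\operatorname{par}(v))$ for $v\in V_{\eta,\kappa}^\circ$ and $(S_{\boldsymbol\lambda}f)(-\kappa)=0$, with domain all $f\in\ell^2(V_{\eta,\kappa})$ for which the function so defined is in $\ell^2(V_{\eta,\kappa})$; "bounded"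 means bounded and everywhere defined. A real sequence $\{a_n\}_{n=0}^\infty$ is completely alternating if $\sum_{j=0}^n(-1)^j\binom nja_{m+j}\le0$ for all integers $m\ge0$, $n\ge1$; equivalently, there is a (unique, finite) positive Borel measure $\tau$ on $[0,1]$, called its representing measure, such that $a_n=a_0+\int_0^1(1+\dots+s^{n-1})\,d\tau(s)$ for $n=1,2,\dots$. A bounded everywhere defined operator $A$ on a Hilbert space $\mathcal H$ is completely hyperexpansive if $\{\|A^nh\|^2\}_{n=0}^\infty$ is completely alternating for every $h\in\mathcal H$. A bounded unilateral classical weighted shift with weights $\{\alpha_n\}_{n=1}^\infty$ is the bounded operator $S$ on $\ell^2(\{0,1,2,\dots\})$ with $Se_n=\alpha_{n+1}e_{n+1}$ for $n\ge0$, $\{e_n\}$ being the standard basis. If $S$ is completely hyperexpansive, the representing measure of $S$ is the representing measure of $\{\|S^ne_0\|^2\}_{n=0}^\infty$. For $k\in\mathbb N$, a unilateral classical weighted shift with positive weights $\{\alpha_n\}_{n=1}^\infty$ has a completely hyperexpansive $k$-step backward extension if for some positive scalars $\alpha_{-k+1},\dots,\alpha_0$ the unilateral classical weighted shift with weights $\{\alpha_{-k+n}\}_{n=1}^\infty$ is completely hyperexpansive. Conventions: $\int_0^1$ means $\int_{[0,1]}$ and $\frac10=\infty$. *)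

theory Defs
  imports "HOL-Probability.Probability" "HOL-Library.Extended_Nat"
begin

text \<open>The space of square-summable complex functions on a set \<open>V\<close> is represented by the functions on
  the ambient type that vanish outside \<open>V\<close>, so that equality of functions is equality of vectors.\<close>

definition ell2 :: "'v set \<Rightarrow> ('v \<Rightarrow> complex) set" where
  "ell2 V = {f. (\<forall>v. v \<notin> V \<longrightarrow> f v = 0) \<and> (\<lambda>v. (cmod (f v))\<^sup>2) summable_on V}"

definition ell2_norm :: "'v set \<Rightarrow> ('v \<Rightarrow> complex) \<Rightarrow> real" where
  "ell2_norm V f = sqrt (\<Sum>\<^sub>\<infinity>v\<in>V. (cmod (f v))\<^sup>2)"

definition bounded_operator :: "'v set \<Rightarrow> (('v \<Rightarrow> complex) \<Rightarrow> ('v \<Rightarrow> complex)) \<Rightarrow> bool" where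
  "bounded_operator V A \<longleftrightarrow>
     (\<forall>f\<in>ell2 V. A f \<in> ell2 V) \<and>
     (\<forall>f\<in>ell2 V. \<forall>g\<in>ell2 V. A (\<lambda>v. f v + g v) = (\<lambda>v. A f v + A g v)) \<and>
     (\<forall>f\<in>ell2 V. \<forall>c. A (\<lambda>v. c * f v) = (\<lambda>v. c * A f v)) \<and>
     (\<exists>C. \<forall>f\<in>ell2 V. ell2_norm V (A f) \<le> C * ell2_norm V f)"

definition op_norm :: "'v set \<Rightarrow> (('v \<Rightarrow> complex) \<Rightarrow> ('v \<Rightarrow> complex)) \<Rightarrow> real" where
  "op_norm V A = (SUP f\<in>{f \<in> ell2 V. ell2_norm V f \<le> 1}. ell2_norm V (A f))"

definition completely_alternating :: "(nat \<Rightarrow> real) \<Rightarrow> bool" where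
  "completely_alternating a \<longleftrightarrow>
     (\<forall>m n. n \<ge> 1 \<longrightarrow> (\<Sum>j=0..n. (-1) ^ j * real (n choose j) * a (m + j)) \<le> 0)"

definition represents :: "real measure \<Rightarrow> (nat \<Rightarrow> real) \<Rightarrow> bool" where
  "represents \<tau> a \<longleftrightarrow>
     sets \<tau> = sets (restrict_space borel {0..1}) \<and> finite_measure \<tau> \<and>
     (\<forall>n\<ge>1. a n = a 0 + (LINT s|\<tau>. (\<Sum>j<n. s ^ j)))"

text \<open>Meaningful for completely alternating sequences, where exactly one representing measure exists.\<close>

definition representing_measure :: "(nat \<Rightarrow> real) \<Rightarrow> real measure" where
  "representing_measure a = (THE \<tau>. represents \<tau> a)"

definition completely_hyperexpansive ::
    "'v set \<Rightarrow> (('v \<Rightarrow> complex) \<Rightarrow> ('v \<Rightarrow> complex)) \<Rightarrow> bool" where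
  "completely_hyperexpansive V A \<longleftrightarrow>
     bounded_operator V A \<and>
     (\<forall>h\<in>ell2 V. completely_alternating (\<lambda>n. (ell2_norm V ((A ^^ n) h))\<^sup>2))"

definition std_basis :: "nat \<Rightarrow> nat \<Rightarrow> complex" where
  "std_basis n = (\<lambda>m. if m = n then 1 else 0)"

text \<open>The weight sequence is indexed from 1; its value at 0 is never used.\<close>

definition unilateral_shift ::
    "(nat \<Rightarrow> real) \<Rightarrow> ((nat \<Rightarrow> complex) \<Rightarrow> (nat \<Rightarrow> complex)) \<Rightarrow> bool" where
  "unilateral_shift \<alpha> S \<longleftrightarrow>
     bounded_operator UNIV S \<and>
     (\<forall>n. S (std_basis n) = (\<lambda>m. complex_of_real (\<alpha> (n + 1)) * std_basis (n + 1) m))"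

definition shift_representing_measure ::
    "((nat \<Rightarrow> complex) \<Rightarrow> (nat \<Rightarrow> complex)) \<Rightarrow> real measure" where
  "shift_representing_measure S =
     representing_measure (\<lambda>n. (ell2_norm UNIV ((S ^^ n) (std_basis 0)))\<^sup>2)"

text \<open>The scalars of a backward extension are indexed by integers: \<open>\<beta>\<close> agrees with \<open>\<alpha>\<close> at positive
  indices, and its values at \<open>-k + 1, \<dots>, 0\<close> are the newly added weights.\<close>

definition has_ch_backward_extension :: "nat \<Rightarrow> (nat \<Rightarrow> real) \<Rightarrow> bool" where
  "has_ch_backward_extension k \<alpha> \<longleftrightarrow>
     (\<exists>\<beta> :: int \<Rightarrow> real.
        (\<forall>n\<ge>1. \<beta> (int n) = \<alpha> n) \<and>
        (\<forall>j\<in>{- int k + 1..0}. \<beta> j > 0) \<and>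
        (\<exists>T. unilateral_shift (\<lambda>n. \<beta> (- int k + int n)) T \<and>
             completely_hyperexpansive UNIV T))"

definition J :: "enat \<Rightarrow> nat set" where
  "J \<iota> = {k. k \<ge> 1 \<and> enat k \<le> \<iota>}"

datatype vertex = Trunk int | Branch nat nat

definition tree_vertices :: "enat \<Rightarrow> nat \<Rightarrow> vertex set" where
  "tree_vertices \<eta> \<kappa> =
     {Trunk (- int k) | k. k \<in> J (enat \<kappa>)} \<union> {Trunk 0} \<union> {Branch i j | i j. i \<in> J \<eta> \<and> j \<ge> 1}"

definition tree_edges :: "enat \<Rightarrow> nat \<Rightarrow> (vertex \<times> vertex) set" where
  "tree_edges \<eta> \<kappa> =
     {(Trunk (- int k), Trunk (- int k + 1)) | k. k \<in> J (enat \<kappa>)} \<union>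
     {(Trunk 0, Branch i 1) | i. i \<in> J \<eta>} \<union>
     {(Branch i j, Branch i (j + 1)) | i j. i \<in> J \<eta> \<and> j \<ge> 1}"

definition tree_root :: "nat \<Rightarrow> vertex" where
  "tree_root \<kappa> = Trunk (- int \<kappa>)"

definition nonroot_vertices :: "enat \<Rightarrow> nat \<Rightarrow> vertex set" where
  "nonroot_vertices \<eta> \<kappa> = tree_vertices \<eta> \<kappa> - {tree_root \<kappa>}"

definition tree_parent :: "enat \<Rightarrow> nat \<Rightarrow> vertex \<Rightarrow> vertex" where
  "tree_parent \<eta> \<kappa> v = (THE u. (u, v) \<in> tree_edges \<eta> \<kappa>)"

text \<open>The weighted shift is given as a map on all functions. As an operator its domain consists of
  those \<open>f\<close> in \<open>ell2\<close> whose image is again in \<open>ell2\<close>, so \<open>bounded_operator\<close> for this map says that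
  the domain is all of \<open>ell2\<close> and that the operator is bounded.\<close>

definition tree_shift :: "enat \<Rightarrow> nat \<Rightarrow> (vertex \<Rightarrow> real) \<Rightarrow> (vertex \<Rightarrow> complex) \<Rightarrow> (vertex \<Rightarrow> complex)" where
  "tree_shift \<eta> \<kappa> w f =
     (\<lambda>v. if v \<in> nonroot_vertices \<eta> \<kappa>
          then complex_of_real (w v) * f (tree_parent \<eta> \<kappa> v) else 0)"

end

theory Submission
  imports Defs
begin

text \<open>
  By Hausdorff's moment theorem a completely alternating sequence \<open>a\<close> has a unique representing measure
  \<open>\<sigma>\<close>, and \<open>n \<mapsto> a (k + n)\<close> is then represented by \<open>s\<^sup>k d\<sigma>\<close>. Hence a sequence \<open>b\<close> with representing measure
  \<open>\<tau>\<close> extends \<open>k\<close> steps backwards to a completely alternating sequence iff \<open>s\<^sup>-\<^sup>k\<close> is \<open>\<tau>\<close>-integrable,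
  and the extension can start with a positive term iff \<open>\<integral> (s\<^sup>-\<^sup>1 + \<dots> + s\<^sup>-\<^sup>k) d\<tau> < b 0\<close>. On the tree the moments
  \<open>\<parallel>S\<^sup>n e\<parallel>\<^sup>2\<close> of the root form a backward extension by \<open>k = \<kappa> + 1\<close> steps of a positive combination
  \<open>\<Sum>i. \<mu>\<^sub>i b\<^sub>i\<close> of the moment sequences of the branches. If such an extension has a positive first term,
  the strict inequality must hold for at least one branch; conversely, if it holds for one branch and the
  other integrals are finite, small coefficients \<open>\<mu>\<^sub>i\<close> on the other branches keep the first term positive.
\<close>

section \<open>Completely alternating sequences\<close>

text \<open>The only freedom in going back from \<open>b\<close> by \<open>k >= 1\<close> steps lies
  at the point 0: off 0 the measure of an extension has to be \<open>s^-k\<close> times that of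
  \<open>b\<close>, while an atom at 0 enlarges the first increment alone and so lowers the first
  term. Existence and positivity of the first term are therefore separate conditions. Positivity
  matters at the root of the tree, where the weights are square roots of quotients of consecutive
  terms; the extensions of single branches may well start below 0.

  Two obstacles shape the route. There may be infinitely many branches, and the sum of their
  measures is never formed: only integrals of polynomials are compared, since they are finite
  combinations of sequence terms, and an increasing limit follows. Besides, hyperexpansivity speaks
  of every vector. In a forest the images of distinct basis vectors have disjoint supports, so
  squared norms add up and the condition reduces to one scalar sequence per vertex.\<close>

primrec bdiff :: "nat \<Rightarrow> (nat \<Rightarrow> real) \<Rightarrow> nat \<Rightarrow> real" where
  "bdiff 0 d m = d m"
| "bdiff (Suc n) d m = bdiff n d m - bdiff n d (Suc m)"

lemma bdiff_eq_sum: "bdiff n d m = (\<Sum>j=0..n. (-1) ^ j * real (n choose j) * d (m + j))"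
proof (induction n arbitrary: m)
  case (Suc n)
  have "(\<Sum>j=0..Suc n. (-1) ^ j * real (Suc n choose j) * d (m + j))
      = d m + (\<Sum>j=0..n. (-1) ^ Suc j * real (Suc n choose Suc j) * d (m + Suc j))"
    by (subst sum.atLeast0_atMost_Suc_shift) simp
  also have "\<dots> = (d m + (\<Sum>j=0..n. (-1) ^ Suc j * real (n choose Suc j) * d (m + Suc j)))
      - (\<Sum>j=0..n. (-1) ^ j * real (n choose j) * d (Suc m + j))"
    by (simp add: algebra_simps sum.distrib sum_subtractf sum_negf)
  also have "d m + (\<Sum>j=0..n. (-1) ^ Suc j * real (n choose Suc j) * d (m + Suc j))
      = (\<Sum>j=0..Suc n. (-1) ^ j * real (n choose j) * d (m + j))"
    by (subst sum.atLeast0_atMost_Suc_shift) simp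
  also have "\<dots> = (\<Sum>j=0..n. (-1) ^ j * real (n choose j) * d (m + j))"
    by simp
  finally show ?case
    by (simp only: Suc.IH bdiff.simps)
qed simp

text \<open>Turns complete alternation into the hypothesis of Hausdorff's theorem: the increments of
  the sequence have nonnegative differences of every order, order 0 included.\<close>

lemma bdiff_diff: "bdiff n (\<lambda>m. d (Suc m) - d m) m = - bdiff (Suc n) d m"
  by (induction n arbitrary: m) auto

lemma completely_alternating_iff_bdiff:
  "completely_alternating a \<longleftrightarrow> (\<forall>m n. bdiff (Suc n) a m \<le> 0)"
proof -
  have "(\<forall>n\<ge>1. P n) \<longleftrightarrow> (\<forall>n. P (Suc n))" for P :: "nat \<Rightarrow> bool"
    by (metis Suc_le_D One_nat_def le_add1 plus_1_eq_Suc)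
  then show ?thesis
    unfolding completely_alternating_def bdiff_eq_sum[symmetric] by (simp del: bdiff.simps)
qed

lemma bdiff_cmult: "bdiff n (\<lambda>m. c * d m) m = c * bdiff n d m"
  by (induction n arbitrary: m) (auto simp: algebra_simps)

lemma bdiff_shift: "bdiff n (\<lambda>m. d (k + m)) m = bdiff n d (k + m)"
  by (induction n arbitrary: m) auto

lemma bdiff_has_sum:
  assumes "\<And>n. ((\<lambda>i. a i n) has_sum s n) I"
  shows "((\<lambda>i. bdiff n (a i) m) has_sum bdiff n s m) I"
proof (induction n arbitrary: m)
  case (Suc n)
  have "((\<lambda>i. bdiff n (a i) m + - bdiff n (a i) (Suc m)) has_sum bdiff n s m + - bdiff n s (Suc m)) I"
    by (intro has_sum_add has_sum_uminusI Suc)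
  then show ?case
    by simp
qed (use assms in simp)

lemma completely_alternating_cmult:
  "completely_alternating a \<Longrightarrow> 0 \<le> c \<Longrightarrow> completely_alternating (\<lambda>n. c * a n)"
  unfolding completely_alternating_iff_bdiff bdiff_cmult
  by (auto simp: mult_nonneg_nonpos simp del: bdiff.simps)

lemma completely_alternating_shift:
  "completely_alternating a \<Longrightarrow> completely_alternating (\<lambda>n. a (k + n))"
  unfolding completely_alternating_iff_bdiff bdiff_shift by blast

text \<open>Each sign condition involves finitely many terms only, so it survives pointwise sums
  over any index set. This serves both for the squared norms of the powers at a general vector and
  for the combination of the branches.\<close>

lemma completely_alternating_has_sum:
  assumes "\<And>i. i \<in> I \<Longrightarrow> completely_alternating (a i)" "\<And>n. ((\<lambda>i. a i n) has_sum s n) I"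
  shows "completely_alternating s"
  unfolding completely_alternating_iff_bdiff
proof (intro allI)
  fix m n
  have "((\<lambda>i. - bdiff (Suc n) (a i) m) has_sum - bdiff (Suc n) s m) I"
    by (intro has_sum_uminusI bdiff_has_sum assms)
  moreover have "0 \<le> - bdiff (Suc n) (a i) m" if "i \<in> I" for i
    using assms(1)[OF that] unfolding completely_alternating_iff_bdiff by (simp only: neg_0_le_iff_le)
  ultimately have "0 \<le> - bdiff (Suc n) s m"
    by (rule has_sum_nonneg)
  then show "bdiff (Suc n) s m \<le> 0"
    by (simp only: neg_0_le_iff_le)
qed

lemma completely_alternating_mono:
  assumes "completely_alternating a" "m \<le> n"
  shows "a m \<le> a n"
proof -
  have "a k \<le> a (Suc k)" for k
    using assms(1)[unfolded completely_alternating_iff_bdiff, rule_format, of 0 k] by simp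
  then show ?thesis
    using assms(2) by (rule lift_Suc_mono_le)
qed

section \<open>The Hausdorff moment problem\<close>

definition unit_measure :: "real measure \<Rightarrow> bool" where
  "unit_measure \<tau> \<longleftrightarrow> sets \<tau> = sets (restrict_space borel {0..1}) \<and> finite_measure \<tau>"

lemma unit_measure_space: "unit_measure \<tau> \<Longrightarrow> space \<tau> = {0..1}"
  unfolding unit_measure_def using sets_eq_imp_space_eq[of \<tau> "restrict_space borel {0..1}"]
  by (simp add: space_restrict_space)

lemma unit_measure_measurable:
  assumes "unit_measure \<tau>" "f \<in> borel_measurable borel"
  shows "f \<in> borel_measurable \<tau>"
proof -
  have "f \<in> borel_measurable (restrict_space borel {0..1})"
    by (rule measurable_restrict_space1[OF assms(2)])
  then show ?thesis
    using assms(1) unfolding unit_measure_def by (simp cong: measurable_cong_sets)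
qed

lemma unit_measure_integrable:
  fixes f :: "real \<Rightarrow> real"
  assumes "unit_measure \<tau>" "f \<in> borel_measurable borel" "\<And>x. x \<in> {0..1} \<Longrightarrow> \<bar>f x\<bar> \<le> B"
  shows "integrable \<tau> f"
proof -
  interpret finite_measure \<tau>
    using assms(1) unfolding unit_measure_def by blast
  show ?thesis
    by (rule integrable_const_bound[of _ B])
      (use assms in \<open>auto simp: unit_measure_space intro!: unit_measure_measurable AE_I2\<close>)
qed

lemma unit_measure_integrable_continuous:
  fixes f :: "real \<Rightarrow> real"
  assumes "unit_measure \<tau>" "continuous_on UNIV f"
  shows "integrable \<tau> f"
proof -
  have "compact (f ` {0..1})"
    using assms(2) by (intro compact_continuous_image) (auto intro: continuous_on_subset)
  then obtain B where "\<forall>x\<in>{0..1}. \<bar>f x\<bar> \<le> B"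
    using compact_imp_bounded by (force simp: bounded_iff)
  then show ?thesis
    using assms by (intro unit_measure_integrable[of _ _ B]) (auto intro: borel_measurable_continuous_onI)
qed

text \<open>Every difference step multiplies the integrand by \<open>1 - s\<close>. Up to binomial
  coefficients the results are integrals of Bernstein polynomials.\<close>

lemma bdiff_moments:
  assumes "unit_measure \<tau>"
  shows "bdiff n (\<lambda>m. LINT s|\<tau>. s ^ m) m = (LINT s|\<tau>. s ^ m * (1 - s) ^ n)"
proof (induction n arbitrary: m)
  case (Suc n)
  have "bdiff (Suc n) (\<lambda>m. LINT s|\<tau>. s ^ m) m
      = (LINT s|\<tau>. s ^ m * (1 - s) ^ n - s ^ Suc m * (1 - s) ^ n)"
    by (subst Bochner_Integration.integral_diff)
      (auto simp: Suc intro!: unit_measure_integrable_continuous[OF assms] continuous_intros)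
  also have "(\<lambda>s::real. s ^ m * (1 - s) ^ n - s ^ Suc m * (1 - s) ^ n) = (\<lambda>s. s ^ m * (1 - s) ^ Suc n)"
    by (auto simp: algebra_simps)
  finally show ?case .
qed simp

text \<open>Telescoping: in terms of the increments, a representing measure solves an ordinary
  moment problem on \<open>[0,1]\<close>.\<close>

lemma represents_iff:
  "represents \<tau> a \<longleftrightarrow> unit_measure \<tau> \<and> (\<forall>n. a (Suc n) - a n = (LINT s|\<tau>. s ^ n))"
proof -
  have sum: "(LINT s|\<tau>. (\<Sum>j<n. s ^ j)) = (\<Sum>j<n. (LINT s|\<tau>. s ^ j))" if "unit_measure \<tau>" for n
    by (rule Bochner_Integration.integral_sum)
      (auto intro!: unit_measure_integrable_continuous[OF that] continuous_intros)
  have "(\<forall>n\<ge>1. a n = a 0 + (\<Sum>j<n. d j)) \<longleftrightarrow> (\<forall>n. a (Suc n) - a n = d n)" for d :: "nat \<Rightarrow> real"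
  proof
    assume *: "\<forall>n\<ge>1. a n = a 0 + (\<Sum>j<n. d j)"
    then have "a n = a 0 + (\<Sum>j<n. d j)" for n
      by (cases n) auto
    then show "\<forall>n. a (Suc n) - a n = d n"
      by (metis add_diff_cancel_left' sum.lessThan_Suc add.assoc)
  next
    assume "\<forall>n. a (Suc n) - a n = d n"
    then have "d = (\<lambda>n. a (Suc n) - a n)"
      by auto
    then show "\<forall>n\<ge>1. a n = a 0 + (\<Sum>j<n. d j)"
      by (simp add: sum_lessThan_telescope)
  qed
  note iff = this[of "\<lambda>n. LINT s|\<tau>. s ^ n"]
  have "represents \<tau> a \<longleftrightarrow> unit_measure \<tau> \<and> (\<forall>n\<ge>1. a n = a 0 + (LINT s|\<tau>. (\<Sum>j<n. s ^ j)))"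
    unfolding represents_def unit_measure_def by blast
  also have "\<dots> \<longleftrightarrow> unit_measure \<tau> \<and> (\<forall>n\<ge>1. a n = a 0 + (\<Sum>j<n. (LINT s|\<tau>. s ^ j)))"
    using sum by (intro conj_cong refl) simp
  finally show ?thesis
    unfolding iff .
qed

lemma represents_imp_completely_alternating:
  assumes "represents \<tau> a"
  shows "completely_alternating a"
  unfolding completely_alternating_iff_bdiff
proof (intro allI)
  fix m n
  have \<tau>: "unit_measure \<tau>" and d: "(\<lambda>n. a (Suc n) - a n) = (\<lambda>n. LINT s|\<tau>. s ^ n)"
    using assms unfolding represents_iff by auto
  have "0 \<le> (LINT s|\<tau>. s ^ m * (1 - s) ^ n)"
    by (rule integral_nonneg_AE, rule AE_I2) (auto simp: unit_measure_space[OF \<tau>])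
  also have "\<dots> = - bdiff (Suc n) a m"
    using bdiff_diff[of n a m] bdiff_moments[OF \<tau>] d by simp
  finally show "bdiff (Suc n) a m \<le> 0"
    by (simp only: neg_0_le_iff_le)
qed

section \<open>Determinacy of the moment problem on the unit interval\<close>

text \<open>Moments fix the integrals of Bernstein polynomials, uniform approximation carries the
  equality to continuous integrands, and continuous ramps increasing to indicators carry it to
  rays.\<close>

lemma unit_measure_eqI:
  assumes \<sigma>: "unit_measure \<sigma>" and \<tau>: "unit_measure \<tau>"
    and moments: "\<And>n. (LINT s|\<sigma>. s ^ n) = (LINT s|\<tau>. s ^ n)"
  shows "\<sigma> = \<tau>"
proof -
  have Bernstein: "(LINT s|\<sigma>. Bernstein n k s) = (LINT s|\<tau>. Bernstein n k s)" for n k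
    using bdiff_moments[OF \<sigma>, of "n - k" k] bdiff_moments[OF \<tau>, of "n - k" k] moments
    by (simp add: Bernstein_def mult.assoc)
  have cont: "(LINT s|\<sigma>. f s) = (LINT s|\<tau>. f s)" if f: "continuous_on UNIV f" for f :: "real \<Rightarrow> real"
  proof -
    define C where "C = measure \<sigma> (space \<sigma>) + measure \<tau> (space \<tau>)"
    have near: "\<bar>(LINT s|\<rho>. f s) - (LINT s|\<rho>. g s)\<bar> \<le> e * measure \<rho> (space \<rho>)"
      if \<rho>: "unit_measure \<rho>" and g: "continuous_on UNIV g" and fg: "\<And>s. s \<in> {0..1} \<Longrightarrow> \<bar>f s - g s\<bar> \<le> e"
      for \<rho> e and g :: "real \<Rightarrow> real"
    proof -
      have int: "integrable \<rho> f" "integrable \<rho> g"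
        by (intro unit_measure_integrable_continuous \<rho> f g)+
      interpret finite_measure \<rho>
        using \<rho> unfolding unit_measure_def by blast
      have "\<bar>(LINT s|\<rho>. f s - g s)\<bar> \<le> (LINT s|\<rho>. \<bar>f s - g s\<bar>)"
        by (rule integral_abs_bound)
      also have "\<dots> \<le> (LINT s|\<rho>. e)"
        using int by (intro integral_mono) (auto simp: unit_measure_space[OF \<rho>] intro!: fg)
      finally show ?thesis
        using int by (simp add: mult.commute)
    qed
    have "\<bar>(LINT s|\<sigma>. f s) - (LINT s|\<tau>. f s)\<bar> \<le> e * C" if e: "0 < e" for e
    proof -
      have "continuous_on {0..1} f"
        using f continuous_on_subset by blast
      from Bernstein_Weierstrass[OF this e] obtain n where
        n: "\<And>x. x \<in> {0..1} \<Longrightarrow> \<bar>f x - (\<Sum>k\<le>n. f (k/n) * Bernstein n k x)\<bar> \<le> e"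
        by (meson less_le_not_le order_refl)
      define g where "g x = (\<Sum>k\<le>n. f (k/n) * Bernstein n k x)" for x
      have g: "continuous_on UNIV g"
        unfolding g_def Bernstein_def by (intro continuous_intros)
      have int: "(LINT s|\<rho>. g s) = (\<Sum>k\<le>n. f (k/n) * (LINT s|\<rho>. Bernstein n k s))"
        if "unit_measure \<rho>" for \<rho>
        unfolding g_def Bernstein_def
        by (subst Bochner_Integration.integral_sum)
          (auto intro!: unit_measure_integrable_continuous[OF that] continuous_intros)
      have "\<bar>(LINT s|\<sigma>. f s) - (LINT s|\<sigma>. g s)\<bar> \<le> e * measure \<sigma> (space \<sigma>)"
           "\<bar>(LINT s|\<tau>. f s) - (LINT s|\<tau>. g s)\<bar> \<le> e * measure \<tau> (space \<tau>)"
        using n g by (auto intro!: near \<sigma> \<tau> simp: g_def)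
      moreover have "(LINT s|\<sigma>. g s) = (LINT s|\<tau>. g s)"
        using int[OF \<sigma>] int[OF \<tau>] Bernstein by simp
      ultimately show ?thesis
        unfolding C_def by (simp add: algebra_simps abs_le_iff)
    qed
    moreover have "((\<lambda>e. e * C) \<longlongrightarrow> 0 * C) (at_right 0)"
      by (intro tendsto_intros)
    ultimately have "\<bar>(LINT s|\<sigma>. f s) - (LINT s|\<tau>. f s)\<bar> \<le> 0 * C"
      by (intro tendsto_lowerbound[of "\<lambda>e. e * C" _ "at_right 0"])
        (auto intro: eventually_mono[OF eventually_at_right_less])
    then show ?thesis
      by simp
  qed
  \<comment> \<open>Measures on the line with finite mass on all rays \<open>{x<..}\<close> are
    determined by these rays, so both measures are transported from the unit interval to the
    line.\<close>
  define E where "E \<rho> = distr \<rho> borel (\<lambda>s::real. s)" for \<rho> :: "real measure"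
  have id: "(\<lambda>s. s) \<in> borel_measurable \<rho>" if "unit_measure \<rho>" for \<rho> :: "real measure"
    by (rule unit_measure_measurable[OF that]) simp
  have ray: "emeasure (E \<rho>) {x<..} = (SUP n. ennreal (LINT s|\<rho>. min 1 (real n * max 0 (s - x))))"
    if \<rho>: "unit_measure \<rho>" for \<rho> x
  proof -
    \<comment> \<open>A ramp: 0 up to \<open>x\<close>, then of slope \<open>n\<close> until it is
      capped at 1.\<close>
    define h where "h n s = min 1 (real n * max 0 (s - x))" for n s
    have "emeasure (E \<rho>) {x<..} = (\<integral>\<^sup>+ s. indicator {x<..} s \<partial>E \<rho>)"
      by (simp add: E_def)
    also have "\<dots> = (\<integral>\<^sup>+ s. indicator {x<..} s \<partial>\<rho>)"
      unfolding E_def using id[OF \<rho>] by (subst nn_integral_distr) auto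
    also have "(\<lambda>s. indicator {x<..} s) = (\<lambda>s. SUP n. ennreal (h n s))"
    proof
      fix s
      show "indicator {x<..} s = (SUP n. ennreal (h n s))"
      proof (cases "x < s")
        case True
        obtain n where "1 / (s - x) < real n"
          using reals_Archimedean2 by blast
        then have "h n s = 1"
          using True by (auto simp: h_def field_simps)
        moreover have "h n s \<le> 1" for n
          by (auto simp: h_def)
        ultimately have "(SUP n. ennreal (h n s)) = 1"
          by (intro antisym SUP_least SUP_upper2[of n]) (auto simp: ennreal_le_1)
        then show ?thesis
          using True by simp
      qed (auto simp: h_def)
    qed
    also have "(\<integral>\<^sup>+ s. (SUP n. ennreal (h n s)) \<partial>\<rho>) = (SUP n. (\<integral>\<^sup>+ s. ennreal (h n s) \<partial>\<rho>))"
    proof (rule nn_integral_monotone_convergence_SUP)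
      show "incseq (\<lambda>n s. ennreal (h n s))"
        by (intro incseq_SucI le_funI ennreal_leI, unfold h_def, intro min.mono mult_right_mono) auto
      show "(\<lambda>s. ennreal (h n s)) \<in> borel_measurable \<rho>" for n
        unfolding h_def by (rule unit_measure_measurable[OF \<rho>, THEN measurable_compose, OF _ measurable_ennreal]) measurable
    qed
    also have "(\<lambda>n. \<integral>\<^sup>+ s. ennreal (h n s) \<partial>\<rho>) = (\<lambda>n. ennreal (LINT s|\<rho>. h n s))"
      unfolding h_def
      by (intro ext nn_integral_eq_integral unit_measure_integrable_continuous \<rho> continuous_intros AE_I2) auto
    finally show ?thesis
      unfolding h_def .
  qed
  have "E \<sigma> = E \<tau>"
  proof (rule measure_eqI_lessThan)
    fix x
    interpret finite_measure \<sigma>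
      using \<sigma> unfolding unit_measure_def by blast
    show "emeasure (E \<sigma>) {x<..} < \<infinity>"
      unfolding E_def using id[OF \<sigma>] by (subst emeasure_distr) (auto simp: less_top[symmetric])
    show "emeasure (E \<sigma>) {x<..} = emeasure (E \<tau>) {x<..}"
      unfolding ray[OF \<sigma>] ray[OF \<tau>] by (subst cont) (auto intro!: continuous_intros)
  qed (auto simp: E_def)
  show ?thesis
  proof (rule measure_eqI)
    show sets: "sets \<sigma> = sets \<tau>"
      using \<sigma> \<tau> by (simp add: unit_measure_def)
    fix A assume A: "A \<in> sets \<sigma>"
    then have "A \<in> sets (restrict_space borel {0..1})"
      using \<sigma> by (simp add: unit_measure_def)
    then have borel: "A \<in> sets borel" and sub: "A \<subseteq> {0..1}"
      by (auto simp: sets_restrict_space_iff)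
    have "emeasure (E \<rho>) A = emeasure \<rho> A" if "unit_measure \<rho>" for \<rho>
      unfolding E_def using id[OF that] borel sub unit_measure_space[OF that]
      by (subst emeasure_distr) (auto simp: Int_absorb2)
    then show "emeasure \<sigma> A = emeasure \<tau> A"
      using \<sigma> \<tau> \<open>E \<sigma> = E \<tau>\<close> by metis
  qed
qed

lemma represents_unique: "represents \<sigma> a \<Longrightarrow> represents \<tau> a \<Longrightarrow> \<sigma> = \<tau>"
  unfolding represents_iff by (auto intro: unit_measure_eqI)

section \<open>Existence of a solution by discrete approximation\<close>

text \<open>Iterating the recursion counts lattice paths: from \<open>(a, b)\<close> the point
  \<open>(a + (n - j), b + j)\<close> is reached along \<open>n choose j\<close> paths. It is
  applied to \<open>F a b = bdiff a d b\<close>.\<close>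

lemma binomial_expand_additive:
  fixes F :: "nat \<Rightarrow> nat \<Rightarrow> real"
  assumes F: "\<And>a b. F a b = F (Suc a) b + F a (Suc b)"
  shows "F a b = (\<Sum>j\<le>n. real (n choose j) * F (a + (n - j)) (b + j))"
proof (induction n arbitrary: a b)
  case (Suc n)
  have "(\<Sum>j\<le>Suc n. real (Suc n choose j) * F (a + (Suc n - j)) (b + j))
      = F (a + Suc n) b + (\<Sum>j\<le>n. real (Suc n choose Suc j) * F (a + (n - j)) (b + Suc j))"
    by (subst sum.atMost_Suc_shift) simp
  also have "\<dots> = (F (a + Suc n) b + (\<Sum>j\<le>n. real (n choose Suc j) * F (a + (n - j)) (b + Suc j)))
      + (\<Sum>j\<le>n. real (n choose j) * F (a + (n - j)) (Suc b + j))"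
    by (simp add: algebra_simps sum.distrib)
  also have "F (a + Suc n) b + (\<Sum>j\<le>n. real (n choose Suc j) * F (a + (n - j)) (b + Suc j))
      = (\<Sum>j\<le>Suc n. real (n choose j) * F (a + (Suc n - j)) (b + j))"
    by (subst sum.atMost_Suc_shift) simp
  also have "\<dots> = (\<Sum>j\<le>n. real (n choose j) * F (Suc a + (n - j)) (b + j))"
    by (simp add: Suc_diff_le)
  finally show ?case
    using F[of a b] Suc[of "Suc a" b] Suc[of a "Suc b"] by simp
qed simp

text \<open>Since \<open>(k choose m) * (N choose k) = (N choose m) * ((N - m) choose (k -
  m))\<close>, what remains is a path count with \<open>N - m\<close> steps. The point of using
  binomial ratios instead of the powers \<open>(k / N) ^ m\<close> is that the identity is exact for
  every \<open>N\<close>.\<close>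

lemma bdiff_factorial_moment:
  assumes "m \<le> N"
  shows "(\<Sum>k\<le>N. (real (k choose m) / real (N choose m)) * (real (N choose k) * bdiff (N - k) d k)) = d m"
proof -
  have pos: "real (N choose m) > 0"
    using assms by simp
  have "(\<Sum>k\<le>N. (real (k choose m) / real (N choose m)) * (real (N choose k) * bdiff (N - k) d k))
      = (\<Sum>k\<in>{m..N}. (real (k choose m) / real (N choose m)) * (real (N choose k) * bdiff (N - k) d k))"
    by (rule sum.mono_neutral_right) auto
  also have "\<dots> = (\<Sum>k\<in>{m..N}. real ((N - m) choose (k - m)) * bdiff (N - k) d k)"
  proof (rule sum.cong[OF refl])
    fix k assume k: "k \<in> {m..N}"
    have "real (k choose m) * real (N choose k) = real (N choose m) * real ((N - m) choose (k - m))"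
      using choose_mult[of m k N] k by (simp flip: of_nat_mult add: mult.commute)
    then show "(real (k choose m) / real (N choose m)) * (real (N choose k) * bdiff (N - k) d k)
        = real ((N - m) choose (k - m)) * bdiff (N - k) d k"
      using pos by (simp add: field_simps)
  qed
  also have "\<dots> = (\<Sum>j\<le>N - m. real ((N - m) choose j) * bdiff (0 + (N - m - j)) d (m + j))"
    by (rule sum.reindex_bij_witness[of _ "\<lambda>j. j + m" "\<lambda>k. k - m"]) (use assms in auto)
  also have "\<dots> = bdiff 0 d m"
    by (rule binomial_expand_additive[symmetric]) simp
  finally show ?thesis
    by simp
qed

text \<open>Both quantities are products of \<open>m\<close> factors, and
  \<open>(k - i) / (N - i)\<close> differs from \<open>k / N\<close> by at most
  \<open>m / (N - m)\<close>.\<close>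

lemma binomial_ratio_approx:
  assumes k: "k \<le> N" and N: "2 * m < N"
  shows "\<bar>real (k choose m) / real (N choose m) - (real k / real N) ^ m\<bar> \<le> real m * (real m / (real N - real m))"
proof -
  have "real (k choose m) / real (N choose m)
      = (\<Prod>i=0..<m. real k - real i) / (\<Prod>i=0..<m. real N - real i)"
    unfolding binomial_gbinomial gbinomial_prod_rev by simp
  also have "\<dots> = (\<Prod>i=0..<m. (real k - real i) / (real N - real i))"
    by (simp add: prod_dividef)
  finally have "real (k choose m) / real (N choose m) - (real k / real N) ^ m
      = (\<Prod>i=0..<m. (real k - real i) / (real N - real i)) - (\<Prod>i=0..<m. real k / real N)"
    by simp
  \<comment> \<open>The product estimate asks for factors of absolute value at most 1. For
    \<open>k < i\<close> the factor is negative, and \<open>2 * m < N\<close> is what bounds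
    it.\<close>
  moreover have "norm ((\<Prod>i=0..<m. (real k - real i) / (real N - real i)) - (\<Prod>i=0..<m. real k / real N))
      \<le> (\<Sum>i=0..<m. norm ((real k - real i) / (real N - real i) - real k / real N))"
    using k N by (intro norm_prod_diff) (auto simp: divide_simps abs_le_iff)
  moreover have "\<dots> \<le> (\<Sum>i=0..<m. real m / (real N - real m))"
  proof (rule sum_mono)
    fix i assume "i \<in> {0..<m}"
    then have i: "i < m" by simp
    have "(real k - real i) / (real N - real i) - real k / real N
        = - (real i * (real N - real k) / (real N * (real N - real i)))"
      using i N by (simp add: field_simps)
    then have "norm ((real k - real i) / (real N - real i) - real k / real N)
        = (real i / (real N - real i)) * ((real N - real k) / real N)"
      using i N k by (simp add: abs_mult)
    also have "\<dots> \<le> (real i / (real N - real i)) * 1"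
      using i N k by (intro mult_left_mono) (auto simp: divide_simps)
    also have "\<dots> \<le> real m / (real N - real m)"
      using i N by (simp, intro frac_le) auto
    finally show "norm ((real k - real i) / (real N - real i) - real k / real N) \<le> real m / (real N - real m)" .
  qed
  ultimately show ?thesis
    by simp
qed

text \<open>The approximating measures put mass proportional to \<open>(N choose k) * bdiff (N - k) d k\<close> at \<open>k / N\<close>;
  their moments converge to \<open>d\<close>, and Helly's selection theorem yields a limit measure.\<close>

lemma hausdorff_moments_pos:
  assumes d: "\<And>n m. 0 \<le> bdiff n d m" and pos: "0 < d 0"
  shows "\<exists>\<tau>. unit_measure \<tau> \<and> (\<forall>n. d n = (LINT s|\<tau>. s ^ n))"
proof -
  \<comment> \<open>Division by \<open>d 0\<close> yields a probability distribution, by the exact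
    identity for \<open>m = 0\<close>.\<close>
  define w where "w N k = real (N choose k) * bdiff (N - k) d k / d 0" for N k
  have w: "0 \<le> w N k" for N k
    using d pos by (simp add: w_def)
  have fmom: "(\<Sum>k\<le>N. (real (k choose m) / real (N choose m)) * w N k) = d m / d 0" if "m \<le> N" for m N
  proof -
    have "(\<Sum>k\<le>N. (real (k choose m) / real (N choose m)) * w N k)
        = (\<Sum>k\<le>N. (real (k choose m) / real (N choose m)) * (real (N choose k) * bdiff (N - k) d k)) / d 0"
      by (simp add: w_def sum_divide_distrib)
    then show ?thesis
      by (simp only: bdiff_factorial_moment[OF that])
  qed
  have w1: "(\<Sum>k\<le>N. w N k) = 1" for N
    using fmom[of 0 N] pos by simp
  define D where "D N = density (count_space {..N}) (\<lambda>k. ennreal (w N k))" for N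
  define \<mu> where "\<mu> N = distr (D N) borel (\<lambda>k. real k / real N)" for N
  have meas: "(\<lambda>k. real k / real N) \<in> measurable (D N) borel" for N
    unfolding D_def by simp
  have prob: "prob_space (D N)" for N
  proof (rule prob_spaceI)
    have "emeasure (D N) (space (D N)) = (\<Sum>k\<le>N. ennreal (w N k))"
      unfolding D_def by (simp add: emeasure_density nn_integral_count_space_finite)
    then show "emeasure (D N) (space (D N)) = 1"
      using w w1[of N] by (simp add: sum_ennreal)
  qed
  have real: "real_distribution (\<mu> N)" for N
    unfolding \<mu>_def by (rule prob_space.real_distribution_distr[OF prob meas])
  have int: "(LINT s|\<mu> N. f s) = (\<Sum>k\<le>N. w N k * f (real k / real N))"
    if "f \<in> borel_measurable borel" for f :: "real \<Rightarrow> real" and N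
    unfolding \<mu>_def
    by (subst integral_distr[OF meas that])
      (simp add: D_def integral_density w lebesgue_integral_count_space_finite)
  have mass: "measure (\<mu> N) {-1<..1} = 1" for N
  proof -
    have "measure (\<mu> N) {-1<..1} = measure (D N) ((\<lambda>k. real k / real N) -` {-1<..1} \<inter> space (D N))"
      unfolding \<mu>_def by (rule measure_distr[OF meas]) simp
    also have "(\<lambda>k. real k / real N) -` {-1<..1} \<inter> space (D N) = space (D N)"
    proof -
      have "- 1 < real k / real N" for k
        by (rule less_le_trans[of _ 0]) auto
      then show ?thesis
        by (auto simp: D_def divide_le_eq_1)
    qed
    finally show ?thesis
      using prob_space.prob_space[OF prob] by simp
  qed
  have "tight \<mu>"
    unfolding tight_def
    by (intro conjI allI impI real exI[of _ "-1"] exI[of _ 1]) (simp_all add: mass)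
  from tight_imp_convergent_subsubsequence[OF this strict_mono_id]
  obtain r M where r: "strict_mono (r :: nat \<Rightarrow> nat)" and M: "real_distribution M"
    and conv: "weak_conv_m (\<lambda>n. \<mu> (r n)) M"
    by (auto simp: o_def)
  interpret M: real_distribution M
    by (rule M)
  \<comment> \<open>The weak limit \<open>M\<close> is a measure on the whole line. Clamping turns
    \<open>s ^ m\<close> into a bounded continuous test function, and the image of \<open>M\<close>
    under \<open>c\<close> lives on \<open>[0,1]\<close> whatever the support of \<open>M\<close>
    is.\<close>
  define c where "c s = max 0 (min 1 s)" for s :: real
  have c_cont: "continuous_on A c" for A
    unfolding c_def by (intro continuous_intros)
  have c01: "c s \<in> {0..1}" for s
    by (auto simp: c_def)
  have moment: "(LINT s|M. c s ^ m) = d m / d 0" for m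
  proof -
    have "(\<lambda>n. LINT s|\<mu> (r n). c s ^ m) \<longlonglongrightarrow> (LINT s|M. c s ^ m)"
    proof (rule weak_conv_imp_integral_bdd_continuous_conv[OF real M conv, where B = 1])
      show "isCont (\<lambda>s. c s ^ m) x" for x
        using c_cont[of UNIV] by (intro continuous_intros) (simp add: continuous_on_eq_continuous_at)
      show "norm (c x ^ m) \<le> 1" for x
        using c01[of x] by (auto simp: power_abs[symmetric] intro!: power_le_one)
    qed
    moreover have "(\<lambda>n. LINT s|\<mu> (r n). c s ^ m) \<longlonglongrightarrow> d m / d 0"
    proof -
      have val: "(LINT s|\<mu> N. c s ^ m) = (\<Sum>k\<le>N. w N k * (real k / real N) ^ m)" for N
      proof -
        have "(\<lambda>s. c s ^ m) \<in> borel_measurable borel"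
          by (intro borel_measurable_continuous_onI continuous_intros c_cont)
        from int[OF this] have "(LINT s|\<mu> N. c s ^ m) = (\<Sum>k\<le>N. w N k * c (real k / real N) ^ m)" .
        also have "\<dots> = (\<Sum>k\<le>N. w N k * (real k / real N) ^ m)"
        proof (intro sum.cong refl)
          fix k assume "k \<in> {..N}"
          then have "0 \<le> real k / real N" "real k / real N \<le> 1"
            by (auto simp: divide_le_eq_1)
          then show "w N k * c (real k / real N) ^ m = w N k * (real k / real N) ^ m"
            by (simp add: c_def)
        qed
        finally show ?thesis .
      qed
      have bound: "norm ((LINT s|\<mu> N. c s ^ m) - d m / d 0) \<le> real m * (real m / (real N - real m))"
        if N: "2 * m < N" for N
      proof -
        have "(LINT s|\<mu> N. c s ^ m) - d m / d 0
            = (\<Sum>k\<le>N. w N k * ((real k / real N) ^ m - real (k choose m) / real (N choose m)))"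
          using fmom[of m N] N unfolding val by (simp add: algebra_simps sum_subtractf)
        also have "norm \<dots> \<le> (\<Sum>k\<le>N. w N k * (real m * (real m / (real N - real m))))"
        proof (rule sum_norm_le)
          fix k assume "k \<in> {..N}"
          then have "\<bar>(real k / real N) ^ m - real (k choose m) / real (N choose m)\<bar>
              \<le> real m * (real m / (real N - real m))"
            using binomial_ratio_approx[of k N m] N by (simp add: abs_minus_commute)
          from mult_left_mono[OF this w[of N k]]
          show "norm (w N k * ((real k / real N) ^ m - real (k choose m) / real (N choose m)))
              \<le> w N k * (real m * (real m / (real N - real m)))"
            using w[of N k] by (simp only: real_norm_def abs_mult abs_of_nonneg)
        qed
        also have "\<dots> = real m * (real m / (real N - real m))"
          by (simp only: sum_distrib_right[symmetric] w1 mult_1)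
        finally show ?thesis .
      qed
      have "(\<lambda>N. real m * (real m / (real N - real m))) \<longlonglongrightarrow> 0"
        by (rule LIMSEQ_offset[of _ m]) (use tendsto_mult_right_zero[OF lim_const_over_n] in simp)
      then have "(\<lambda>N. (LINT s|\<mu> N. c s ^ m) - d m / d 0) \<longlonglongrightarrow> 0"
        by (rule Lim_null_comparison[rotated])
          (use bound in \<open>auto intro!: eventually_mono[OF eventually_gt_at_top[of "2 * m"]]\<close>)
      then have "(\<lambda>N. LINT s|\<mu> N. c s ^ m) \<longlonglongrightarrow> d m / d 0"
        by (rule LIM_zero_cancel)
      then show ?thesis
        using LIMSEQ_subseq_LIMSEQ[OF _ r] by (force simp: o_def)
    qed
    ultimately show ?thesis
      by (rule LIMSEQ_unique)
  qed
  define U where "U = restrict_space borel {0..1::real}"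
  define P where "P = distr M U c"
  have c_meas: "c \<in> measurable M U"
  proof -
    have [measurable]: "c \<in> borel_measurable borel"
      by (intro borel_measurable_continuous_onI c_cont)
    have "c \<in> borel_measurable M"
      by measurable
    then show ?thesis
      unfolding U_def using c01 by (intro measurable_restrict_space2) auto
  qed
  \<comment> \<open>Undoes the normalisation by \<open>d 0\<close>.\<close>
  define \<tau> where "\<tau> = density P (\<lambda>_. ennreal (d 0))"
  have "unit_measure \<tau>"
    unfolding unit_measure_def
  proof
    show "sets \<tau> = sets (restrict_space borel {0..1})"
      by (simp add: \<tau>_def P_def U_def)
    interpret P: prob_space P
      unfolding P_def by (rule M.prob_space_distr[OF c_meas])
    show "finite_measure \<tau>"
      by (rule finite_measureI) (simp add: \<tau>_def emeasure_density ennreal_mult_eq_top_iff P.emeasure_space_1)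
  qed
  moreover have "d n = (LINT s|\<tau>. s ^ n)" for n
  proof -
    have pm: "(\<lambda>s. s ^ n) \<in> borel_measurable U"
      unfolding U_def by (rule measurable_restrict_space1) simp
    then have "(LINT s|\<tau>. s ^ n) = (LINT s|P. d 0 *\<^sub>R s ^ n)"
      unfolding \<tau>_def using pos by (subst integral_density) (auto simp: P_def)
    also have "\<dots> = d 0 * (LINT s|P. s ^ n)"
      by simp
    also have "(LINT s|P. s ^ n) = (LINT s|M. c s ^ n)"
      unfolding P_def by (rule integral_distr[OF c_meas pm])
    finally show ?thesis
      using pos moment by simp
  qed
  ultimately show ?thesis
    by blast
qed

text \<open>If \<open>d 0\<close> is not positive there is nothing to normalise; then monotonicity
  and nonnegativity make \<open>d\<close> vanish, and the null measure serves.\<close>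

lemma hausdorff_moments:
  assumes d: "\<And>n m. 0 \<le> bdiff n d m"
  shows "\<exists>\<tau>. unit_measure \<tau> \<and> (\<forall>n. d n = (LINT s|\<tau>. s ^ n))"
proof (cases "0 < d 0")
  case False
  have "d (Suc n) \<le> d n" for n
    using d[of 1 n] by simp
  then have "d n \<le> d 0" for n
    by (rule lift_Suc_antimono_le) simp
  then have "d n = 0" for n
    using d[of 0 n] False by (smt (verit) bdiff.simps(1))
  moreover have "unit_measure (null_measure (restrict_space borel {0..1}))"
    unfolding unit_measure_def by (auto intro: finite_measureI)
  ultimately show ?thesis
    by (intro exI[of _ "null_measure (restrict_space borel {0..1})"]) simp
qed (use hausdorff_moments_pos d in blast)

lemma completely_alternating_imp_represents:
  assumes "completely_alternating a"
  shows "\<exists>\<tau>. represents \<tau> a"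
proof -
  have "0 \<le> bdiff n (\<lambda>m. a (Suc m) - a m) m" for n m
    using assms unfolding bdiff_diff completely_alternating_iff_bdiff by (simp only: neg_0_le_iff_le)
  from hausdorff_moments[OF this] show ?thesis
    unfolding represents_iff by metis
qed

lemma represents_representing_measure:
  "completely_alternating a \<Longrightarrow> represents (representing_measure a) a"
  unfolding representing_measure_def
  by (rule theI') (meson completely_alternating_imp_represents represents_unique)

section \<open>Backward extensions of completely alternating sequences\<close>

lemma unit_measure_nn_integral_eq:
  fixes f :: "real \<Rightarrow> real"
  assumes "unit_measure \<tau>" "continuous_on UNIV f" "\<And>s. s \<in> {0..1} \<Longrightarrow> 0 \<le> f s"
  shows "(\<integral>\<^sup>+ s. ennreal (f s) \<partial>\<tau>) = ennreal (LINT s|\<tau>. f s)"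
  by (rule nn_integral_eq_integral)
    (use assms in \<open>auto simp: unit_measure_space intro!: unit_measure_integrable_continuous\<close>)

text \<open>The extension is represented by \<open>s^-k\<close> times \<open>\<tau>\<close>. For
  \<open>k >= 1\<close> this measure has no atom at 0, so the drop from \<open>b 0\<close> to
  \<open>a 0\<close> is the least that \<open>backward_extension_bound\<close>, taken for a single
  sequence, permits.\<close>

lemma backward_extension_exists:
  assumes rep: "represents \<tau> b" and fin: "(\<integral>\<^sup>+ s. 1 / ennreal (s ^ k) \<partial>\<tau>) < \<infinity>"
  obtains a where "completely_alternating a" "\<And>n. a (k + n) = b n"
    "ennreal (b 0 - a 0) = (\<integral>\<^sup>+ s. (\<Sum>j=1..k. 1 / ennreal (s ^ j)) \<partial>\<tau>)"
proof -
  have \<tau>: "unit_measure \<tau>" and b: "\<And>n. b (Suc n) - b n = (LINT s|\<tau>. s ^ n)"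
    using rep unfolding represents_iff by auto
  define g where "g s = 1 / ennreal (s ^ k)" for s :: real
  have g_borel: "g \<in> borel_measurable borel"
    unfolding g_def by measurable
  have borel_\<tau>: "h \<in> borel_measurable \<tau>" if "h \<in> borel_measurable borel" for h :: "real \<Rightarrow> ennreal"
  proof -
    have "h \<in> borel_measurable (restrict_space borel {0..1})"
      by (rule measurable_restrict_space1[OF that])
    then show ?thesis
      using \<tau> unfolding unit_measure_def by (simp cong: measurable_cong_sets)
  qed
  have g_meas: "g \<in> borel_measurable \<tau>"
    by (rule borel_\<tau>[OF g_borel])
  define \<sigma> where "\<sigma> = density \<tau> g"
  have \<sigma>: "unit_measure \<sigma>"
    unfolding unit_measure_def
  proof
    show "sets \<sigma> = sets (restrict_space borel {0..1})"
      using \<tau> by (simp add: \<sigma>_def unit_measure_def)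
    have "emeasure \<sigma> (space \<sigma>) = (\<integral>\<^sup>+ s. g s \<partial>\<tau>)"
      unfolding \<sigma>_def using g_meas by (simp add: emeasure_density cong: nn_integral_cong)
    then show "finite_measure \<sigma>"
      using fin by (intro finite_measureI) (auto simp: g_def)
  qed
  \<comment> \<open>As \<open>1 / ennreal 0\<close> is infinite, a finite integral excludes an atom
    of \<open>\<tau>\<close> at 0 unless \<open>k = 0\<close>.\<close>
  have AE: "AE s in \<tau>. g s \<noteq> \<infinity>"
    using nn_integral_PInf_AE[OF g_meas] fin unfolding g_def by auto
  have mom: "ennreal (LINT s|\<sigma>. s ^ j) = (\<integral>\<^sup>+ s. g s * ennreal (s ^ j) \<partial>\<tau>)" for j
    unfolding \<sigma>_def using g_meas
    by (subst unit_measure_nn_integral_eq[symmetric])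
      (auto intro!: continuous_intros nn_integral_density borel_\<tau> \<sigma>[unfolded \<sigma>_def])
  have g_mult: "g s * ennreal (s ^ j) = (if j < k then 1 / ennreal (s ^ (k - j)) else ennreal (s ^ (j - k)))"
    if "g s \<noteq> \<infinity>" "s \<in> {0..1}" for s j
  proof (cases "s = 0")
    case True
    then have "k = 0"
      using that(1) by (cases k) (auto simp: g_def)
    then show ?thesis
      using True by (simp add: g_def)
  next
    case False
    then have "s > 0"
      using that(2) by auto
    then show ?thesis
      by (auto simp: g_def divide_ennreal ennreal_mult[symmetric] power_diff
          simp flip: ennreal_1)
  qed
  have mom_low: "ennreal (LINT s|\<sigma>. s ^ j) = (\<integral>\<^sup>+ s. 1 / ennreal (s ^ (k - j)) \<partial>\<tau>)" if "j < k" for j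
    unfolding mom using AE that
    by (intro nn_integral_cong_AE) (auto simp: g_mult unit_measure_space[OF \<tau>] intro: AE_mp AE_I2)
  have mom_high: "(LINT s|\<sigma>. s ^ (k + j)) = (LINT s|\<tau>. s ^ j)" for j
  proof -
    have "ennreal (LINT s|\<sigma>. s ^ (k + j)) = (\<integral>\<^sup>+ s. ennreal (s ^ j) \<partial>\<tau>)"
      unfolding mom using AE
      by (intro nn_integral_cong_AE) (auto simp: g_mult unit_measure_space[OF \<tau>] intro: AE_mp AE_I2)
    also have "\<dots> = ennreal (LINT s|\<tau>. s ^ j)"
      by (rule unit_measure_nn_integral_eq[OF \<tau>]) (auto intro!: continuous_intros)
    finally show ?thesis
      by (subst (asm) ennreal_inj)
        (auto intro!: integral_nonneg_AE simp: unit_measure_space[OF \<tau>] unit_measure_space[OF \<sigma>])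
  qed
  \<comment> \<open>The increments are the moments of \<open>\<sigma>\<close>; the constant is
    chosen to give \<open>a k = b 0\<close>.\<close>
  define a where "a n = b 0 - (\<Sum>j<k. LINT s|\<sigma>. s ^ j) + (\<Sum>j<n. LINT s|\<sigma>. s ^ j)" for n
  show ?thesis
  proof
    have "represents \<sigma> a"
      unfolding represents_iff using \<sigma> by (simp add: a_def)
    then show "completely_alternating a"
      by (rule represents_imp_completely_alternating)
    show "a (k + n) = b n" for n
    proof (induction n)
      case (Suc n)
      have "a (k + Suc n) = a (k + n) + (LINT s|\<sigma>. s ^ (k + n))"
        by (simp add: a_def)
      then show ?case
        using Suc b[of n] mom_high[of n] by simp
    qed (simp add: a_def)
    have "ennreal (b 0 - a 0) = (\<Sum>j<k. ennreal (LINT s|\<sigma>. s ^ j))"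
      by (subst sum_ennreal)
        (auto simp: a_def intro!: integral_nonneg_AE simp: unit_measure_space[OF \<sigma>])
    also have "\<dots> = (\<Sum>j<k. (\<integral>\<^sup>+ s. 1 / ennreal (s ^ (k - j)) \<partial>\<tau>))"
      by (intro sum.cong refl mom_low) simp
    also have "\<dots> = (\<Sum>j=1..k. (\<integral>\<^sup>+ s. 1 / ennreal (s ^ j) \<partial>\<tau>))"
      by (rule sum.reindex_bij_witness[of _ "\<lambda>j. k - j" "\<lambda>j. k - j"]) auto
    also have "\<dots> = (\<integral>\<^sup>+ s. (\<Sum>j=1..k. 1 / ennreal (s ^ j)) \<partial>\<tau>)"
      by (rule nn_integral_sum[symmetric]) (auto intro!: borel_\<tau>)
    finally show "ennreal (b 0 - a 0) = (\<integral>\<^sup>+ s. (\<Sum>j=1..k. 1 / ennreal (s ^ j)) \<partial>\<tau>)" .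
  qed
qed

section \<open>The bound obeyed by every backward extension\<close>

text \<open>Only finitely many terms of the sequence enter, and this lets a sum over infinitely many
  branches pass from sequences to integrals.\<close>

lemma LINT_polynomial:
  assumes rep: "represents \<tau> b"
  shows "(LINT s|\<tau>. (\<Sum>l\<le>n. c l * s ^ l) * s ^ k) = (\<Sum>l\<le>n. c l * (b (Suc (k + l)) - b (k + l)))"
proof -
  have \<tau>: "unit_measure \<tau>" and b: "\<And>n. b (Suc n) - b n = (LINT s|\<tau>. s ^ n)"
    using rep unfolding represents_iff by auto
  have "(LINT s|\<tau>. (\<Sum>l\<le>n. c l * s ^ l) * s ^ k) = (LINT s|\<tau>. (\<Sum>l\<le>n. c l * s ^ (k + l)))"
    unfolding sum_distrib_right power_add by (simp only: mult_ac)
  also have "\<dots> = (\<Sum>l\<le>n. c l * (LINT s|\<tau>. s ^ (k + l)))"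
    by (subst Bochner_Integration.integral_sum)
      (auto intro!: unit_measure_integrable_continuous[OF \<tau>] continuous_intros)
  finally show ?thesis
    by (simp add: b)
qed

text \<open>The truncated geometric series \<open>\<Sum>m<N. (1 - s) ^ m\<close> increases to \<open>1 / s\<close>.\<close>

definition approx_recip_sum :: "nat \<Rightarrow> nat \<Rightarrow> real \<Rightarrow> real" where
  "approx_recip_sum k N s = (\<Sum>j=1..k. (\<Sum>m<N. (1 - s) ^ m) ^ j)"

lemma approx_recip_sum_polynomial:
  "\<exists>c n. approx_recip_sum k N = (\<lambda>s. \<Sum>l\<le>n. c l * s ^ l)"
proof -
  have "real_polynomial_function (\<lambda>s::real. s)"
    by (rule real_polynomial_function.intros(1)) (rule bounded_linear_ident)
  then have "real_polynomial_function (approx_recip_sum k N)"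
    unfolding approx_recip_sum_def
    by (intro real_polynomial_function_sum real_polynomial_function_power real_polynomial_function_diff
        real_polynomial_function.intros(2)) auto
  then show ?thesis
    unfolding real_polynomial_function_iff_sum by auto
qed

lemma approx_recip_sum_nonneg: "s \<in> {0..1} \<Longrightarrow> 0 \<le> approx_recip_sum k N s"
  unfolding approx_recip_sum_def by (intro sum_nonneg zero_le_power) auto

lemma approx_recip_sum_continuous: "continuous_on UNIV (approx_recip_sum k N)"
  unfolding approx_recip_sum_def by (intro continuous_intros)

text \<open>With \<open>q\<close> the truncated series, \<open>s * q = 1 - (1 - s) ^ N\<close> is at
  most 1, so \<open>q ^ j * s ^ k\<close> is at most \<open>s ^ (k - j)\<close>. The point 0 is
  covered too, which matters because the measure of the extension may have an atom there.\<close>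

lemma approx_recip_sum_mult_le:
  assumes s: "s \<in> {0..1}"
  shows "approx_recip_sum k N s * s ^ k \<le> (\<Sum>l<k. s ^ l)"
proof -
  define q where "q = (\<Sum>m<N. (1 - s) ^ m)"
  have sq: "s * q = 1 - (1 - s) ^ N"
    using one_diff_power_eq[of "1 - s" N] by (simp add: q_def)
  have "approx_recip_sum k N s * s ^ k = (\<Sum>j=1..k. (s * q) ^ j * s ^ (k - j))"
    unfolding approx_recip_sum_def q_def[symmetric] sum_distrib_right
    by (intro sum.cong refl) (simp add: power_mult_distrib mult.assoc mult.left_commute flip: power_add)
  also have "\<dots> \<le> (\<Sum>j=1..k. s ^ (k - j))"
    unfolding sq using s
    by (intro sum_mono mult_left_le_one_le zero_le_power power_le_one) (auto intro!: power_le_one)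
  also have "\<dots> = (\<Sum>l<k. s ^ l)"
    by (rule sum.reindex_bij_witness[of _ "\<lambda>j. k - j" "\<lambda>j. k - j"]) auto
  finally show ?thesis .
qed

lemma approx_recip_sum_mono:
  assumes s: "s \<in> {0..1}" and "M \<le> N"
  shows "approx_recip_sum k M s \<le> approx_recip_sum k N s"
  unfolding approx_recip_sum_def using assms
  by (intro sum_mono power_mono sum_mono2 sum_nonneg) auto

lemma approx_recip_sum_tendsto:
  assumes s: "s \<in> {0..1}"
  shows "(\<lambda>N. ennreal (approx_recip_sum k N s)) \<longlonglongrightarrow> (\<Sum>j=1..k. 1 / ennreal (s ^ j))"
proof -
  have "(\<lambda>N. ennreal ((\<Sum>m<N. (1 - s) ^ m) ^ j)) \<longlonglongrightarrow> 1 / ennreal (s ^ j)" if "1 \<le> j" for j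
  proof (cases "s = 0")
    \<comment> \<open>At 0 the truncated series equals \<open>N\<close>, in accordance with the
      infinite value of \<open>1 / ennreal 0\<close>.\<close>
    case True
    have "filterlim (\<lambda>N. real N ^ j) at_top sequentially"
      using that by (intro filterlim_pow_at_top filterlim_real_sequentially) auto
    moreover have "1 / ennreal (s ^ j) = top"
      using True that by (cases j) auto
    ultimately show ?thesis
      using True by (simp add: ennreal_tendsto_top_eq_at_top)
  next
    case False
    then have "(\<lambda>m. (1 - s) ^ m) sums (1 / (1 - (1 - s)))"
      using s by (intro geometric_sums) auto
    then have "(\<lambda>N. (\<Sum>m<N. (1 - s) ^ m) ^ j) \<longlonglongrightarrow> (1 / s) ^ j"
      unfolding sums_def by (intro tendsto_power) simp
    moreover have "1 / ennreal (s ^ j) = ennreal ((1 / s) ^ j)"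
      using s False divide_ennreal[of 1 "s ^ j"] by (simp add: power_one_over)
    ultimately show ?thesis
      by (simp add: tendsto_ennrealI)
  qed
  then have "(\<lambda>N. \<Sum>j=1..k. ennreal ((\<Sum>m<N. (1 - s) ^ m) ^ j)) \<longlonglongrightarrow> (\<Sum>j=1..k. 1 / ennreal (s ^ j))"
    by (intro tendsto_sum) auto
  moreover have "ennreal (approx_recip_sum k N s) = (\<Sum>j=1..k. ennreal ((\<Sum>m<N. (1 - s) ^ m) ^ j))" for N
    unfolding approx_recip_sum_def using s by (intro sum_ennreal[symmetric] zero_le_power sum_nonneg) auto
  ultimately show ?thesis
    by simp
qed

lemma has_sum_sum:
  fixes f :: "'i \<Rightarrow> 'j \<Rightarrow> real"
  assumes "\<And>j. j \<in> B \<Longrightarrow> ((\<lambda>i. f i j) has_sum s j) A"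
  shows "((\<lambda>i. \<Sum>j\<in>B. f i j) has_sum (\<Sum>j\<in>B. s j)) A"
  using assms by (induction B rule: infinite_finite_induct) (auto intro!: has_sum_add)

text \<open>Formally, \<open>s^k\<close> times \<open>\<sigma>\<close> is the sum of the measures
  \<open>\<tau> i\<close> with coefficients \<open>\<mu> i\<close>; integrating
  \<open>s^-1 + ... + s^-k\<close> against it amounts to integrating
  \<open>1 + ... + s^(k-1)\<close> against \<open>\<sigma>\<close>. The result is only an
  inequality, because the left side does not see an atom of \<open>\<sigma>\<close> at 0 and
  \<open>F\<close> may omit branches.\<close>

lemma backward_extension_bound:
  assumes a: "completely_alternating a"
    and rep: "\<And>i. i \<in> I \<Longrightarrow> represents (\<tau> i) (b i)"
    and \<mu>: "\<And>i. i \<in> I \<Longrightarrow> 0 \<le> \<mu> i"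
    and sum: "\<And>n. ((\<lambda>i. \<mu> i * b i n) has_sum a (k + n)) I"
    and F: "finite F" "F \<subseteq> I"
  shows "(\<Sum>i\<in>F. ennreal (\<mu> i) * (\<integral>\<^sup>+ s. (\<Sum>j=1..k. 1 / ennreal (s ^ j)) \<partial>\<tau> i)) \<le> ennreal (a k - a 0)"
proof -
  obtain \<sigma> where \<sigma>rep: "represents \<sigma> a"
    using completely_alternating_imp_represents[OF a] by blast
  then have \<sigma>: "unit_measure \<sigma>" and a_diff: "\<And>n. a (Suc n) - a n = (LINT s|\<sigma>. s ^ n)"
    unfolding represents_iff by auto
  have \<tau>: "unit_measure (\<tau> i)" if "i \<in> I" for i
    using rep[OF that] unfolding represents_iff by auto
  let ?P = "approx_recip_sum k"
  \<comment> \<open>For a polynomial the comparison is an identity over all of \<open>I\<close>. The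
    two inequalities come from dropping the indices outside \<open>F\<close> and from bounding
    \<open>?P N s * s ^ k\<close>.\<close>
  have bound: "(\<Sum>i\<in>F. ennreal (\<mu> i) * (\<integral>\<^sup>+ s. ennreal (?P N s) \<partial>\<tau> i)) \<le> ennreal (a k - a 0)" for N
  proof -
    obtain c n where c: "?P N = (\<lambda>s. \<Sum>l\<le>n. c l * s ^ l)"
      using approx_recip_sum_polynomial by blast
    have "((\<lambda>i. \<Sum>l\<le>n. c l * (\<mu> i * b i (Suc l) - \<mu> i * b i l)) has_sum
        (\<Sum>l\<le>n. c l * (a (k + Suc l) - a (k + l)))) I"
    proof (intro has_sum_sum has_sum_cmult_right)
      fix l
      have "((\<lambda>i. \<mu> i * b i (Suc l) + - (\<mu> i * b i l)) has_sum (a (k + Suc l) + - a (k + l))) I"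
        by (intro has_sum_add has_sum_uminusI sum)
      then show "((\<lambda>i. \<mu> i * b i (Suc l) - \<mu> i * b i l) has_sum (a (k + Suc l) - a (k + l))) I"
        by simp
    qed
    also have "(\<Sum>l\<le>n. c l * (a (k + Suc l) - a (k + l))) = (LINT s|\<sigma>. ?P N s * s ^ k)"
      using LINT_polynomial[OF \<sigma>rep, of c n k] by (simp add: c)
    finally have "((\<lambda>i. \<mu> i * (LINT s|\<tau> i. ?P N s)) has_sum (LINT s|\<sigma>. ?P N s * s ^ k)) I"
    proof (rule has_sum_cong[THEN iffD1, rotated])
      fix i assume "i \<in> I"
      show "(\<Sum>l\<le>n. c l * (\<mu> i * b i (Suc l) - \<mu> i * b i l)) = \<mu> i * (LINT s|\<tau> i. ?P N s)"
        using LINT_polynomial[OF rep[OF \<open>i \<in> I\<close>], of c n 0]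
        by (simp add: c sum_distrib_left algebra_simps)
    qed
    moreover have nonneg: "0 \<le> (LINT s|\<tau> i. ?P N s)" if "i \<in> I" for i
      by (intro integral_nonneg_AE AE_I2) (auto simp: unit_measure_space[OF \<tau>[OF that]] approx_recip_sum_nonneg)
    ultimately have "(\<Sum>i\<in>F. \<mu> i * (LINT s|\<tau> i. ?P N s)) \<le> (LINT s|\<sigma>. ?P N s * s ^ k)"
      using F \<mu> by (intro finite_sum_le_has_sum[where A = I]) auto
    also have "\<dots> \<le> (LINT s|\<sigma>. (\<Sum>l<k. s ^ l))"
      by (intro integral_mono)
        (auto intro!: unit_measure_integrable_continuous[OF \<sigma>] continuous_intros approx_recip_sum_continuous
          approx_recip_sum_mult_le simp: unit_measure_space[OF \<sigma>])
    also have "\<dots> = (\<Sum>l<k. LINT s|\<sigma>. s ^ l)"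
      by (rule Bochner_Integration.integral_sum)
        (auto intro!: unit_measure_integrable_continuous[OF \<sigma>] continuous_intros)
    also have "\<dots> = a k - a 0"
      by (simp add: a_diff[symmetric] sum_lessThan_telescope)
    finally have le: "(\<Sum>i\<in>F. \<mu> i * (LINT s|\<tau> i. ?P N s)) \<le> a k - a 0" .
    have "(\<Sum>i\<in>F. ennreal (\<mu> i) * (\<integral>\<^sup>+ s. ennreal (?P N s) \<partial>\<tau> i)) = (\<Sum>i\<in>F. ennreal (\<mu> i * (LINT s|\<tau> i. ?P N s)))"
    proof (rule sum.cong[OF refl])
      fix i assume "i \<in> F"
      then have i: "i \<in> I" using F by blast
      show "ennreal (\<mu> i) * (\<integral>\<^sup>+ s. ennreal (?P N s) \<partial>\<tau> i) = ennreal (\<mu> i * (LINT s|\<tau> i. ?P N s))"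
        using \<mu>[OF i] nonneg[OF i]
          unit_measure_nn_integral_eq[OF \<tau>[OF i] approx_recip_sum_continuous[of k N] approx_recip_sum_nonneg]
        by (simp add: ennreal_mult)
    qed
    also have "\<dots> = ennreal (\<Sum>i\<in>F. \<mu> i * (LINT s|\<tau> i. ?P N s))"
      using F \<mu> nonneg by (intro sum_ennreal mult_nonneg_nonneg) auto
    also have "\<dots> \<le> ennreal (a k - a 0)"
      by (rule ennreal_leI[OF le])
    finally show ?thesis .
  qed
  have lim: "(\<lambda>N. \<integral>\<^sup>+ s. ennreal (?P N s) \<partial>\<tau> i) \<longlonglongrightarrow> (\<integral>\<^sup>+ s. (\<Sum>j=1..k. 1 / ennreal (s ^ j)) \<partial>\<tau> i)"
    if i: "i \<in> I" for i
  proof -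
    have eq: "(\<Sum>j=1..k. 1 / ennreal (s ^ j)) = (SUP N. ennreal (?P N s))" if "s \<in> {0..1}" for s
    proof -
      have "incseq (\<lambda>N. ennreal (?P N s))"
        using approx_recip_sum_mono[OF that] by (auto simp: incseq_def intro: ennreal_leI)
      from LIMSEQ_SUP[OF this] approx_recip_sum_tendsto[OF that, of k] show ?thesis
        by (rule LIMSEQ_unique[rotated])
    qed
    have "(\<integral>\<^sup>+ s. (\<Sum>j=1..k. 1 / ennreal (s ^ j)) \<partial>\<tau> i) = (\<integral>\<^sup>+ s. (SUP N. ennreal (?P N s)) \<partial>\<tau> i)"
      by (intro nn_integral_cong eq) (simp add: unit_measure_space[OF \<tau>[OF i]])
    also have "\<dots> = (SUP N. \<integral>\<^sup>+ s. ennreal (?P N s) \<partial>\<tau> i)"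
    proof (rule nn_integral_monotone_convergence_SUP_AE)
      show "AE s in \<tau> i. ennreal (?P N s) \<le> ennreal (?P (Suc N) s)" for N
        by (rule AE_I2) (auto simp: unit_measure_space[OF \<tau>[OF i]] intro!: ennreal_leI approx_recip_sum_mono)
      show "(\<lambda>s. ennreal (?P N s)) \<in> borel_measurable (\<tau> i)" for N
        by (intro measurable_compose[OF _ measurable_ennreal] unit_measure_measurable[OF \<tau>[OF i]]
            borel_measurable_continuous_onI approx_recip_sum_continuous)
    qed
    finally have eq2: "(\<integral>\<^sup>+ s. (\<Sum>j=1..k. 1 / ennreal (s ^ j)) \<partial>\<tau> i) = (SUP N. \<integral>\<^sup>+ s. ennreal (?P N s) \<partial>\<tau> i)" .
    have "incseq (\<lambda>N. \<integral>\<^sup>+ s. ennreal (?P N s) \<partial>\<tau> i)"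
      unfolding incseq_def
      by (auto intro!: nn_integral_mono ennreal_leI approx_recip_sum_mono simp: unit_measure_space[OF \<tau>[OF i]])
    from LIMSEQ_SUP[OF this] show ?thesis
      unfolding eq2 .
  qed
  have "(\<lambda>N. \<Sum>i\<in>F. ennreal (\<mu> i) * (\<integral>\<^sup>+ s. ennreal (?P N s) \<partial>\<tau> i)) \<longlonglongrightarrow>
      (\<Sum>i\<in>F. ennreal (\<mu> i) * (\<integral>\<^sup>+ s. (\<Sum>j=1..k. 1 / ennreal (s ^ j)) \<partial>\<tau> i))"
    using F by (intro tendsto_sum ennreal_tendsto_cmult lim) auto
  then show ?thesis
    by (rule LIMSEQ_le_const2) (use bound in auto)
qed

section \<open>Weighted shifts on rooted forests\<close>

lemma ell2_add:
  assumes "f \<in> ell2 V" "g \<in> ell2 V"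
  shows "(\<lambda>v. f v + g v) \<in> ell2 V"
proof -
  have "(\<lambda>v. (cmod (f v + g v))\<^sup>2) summable_on V"
  proof (rule summable_on_comparison_test)
    show "(\<lambda>v. 2 * (cmod (f v))\<^sup>2 + 2 * (cmod (g v))\<^sup>2) summable_on V"
      using assms by (intro summable_on_add summable_on_cmult_right) (auto simp: ell2_def)
    fix v
    have "(cmod (f v + g v))\<^sup>2 \<le> (cmod (f v) + cmod (g v))\<^sup>2"
      by (intro power_mono norm_triangle_ineq) auto
    also have "\<dots> \<le> 2 * (cmod (f v))\<^sup>2 + 2 * (cmod (g v))\<^sup>2"
      using sum_squares_bound[of "cmod (f v)" "cmod (g v)"] by (simp add: power2_sum)
    finally show "(cmod (f v + g v))\<^sup>2 \<le> 2 * (cmod (f v))\<^sup>2 + 2 * (cmod (g v))\<^sup>2" .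
  qed auto
  then show ?thesis
    using assms by (auto simp: ell2_def)
qed

lemma ell2_cmult: "f \<in> ell2 V \<Longrightarrow> (\<lambda>v. c * f v) \<in> ell2 V"
  by (auto simp: ell2_def norm_mult power_mult_distrib intro!: summable_on_cmult_right)

lemma ell2_norm_nonneg: "0 \<le> ell2_norm V f"
  by (simp add: ell2_norm_def infsum_nonneg)

lemma ell2_has_sum:
  "f \<in> ell2 V \<Longrightarrow> ((\<lambda>v. (cmod (f v))\<^sup>2) has_sum (ell2_norm V f)\<^sup>2) V"
  by (simp add: ell2_def ell2_norm_def infsum_nonneg)

lemma cmod_le_ell2_norm:
  assumes "f \<in> ell2 V" "v \<in> V"
  shows "cmod (f v) \<le> ell2_norm V f"
proof -
  have "(\<Sum>u\<in>{v}. (cmod (f u))\<^sup>2) \<le> (ell2_norm V f)\<^sup>2"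
    using assms by (intro finite_sum_le_has_sum[OF ell2_has_sum]) auto
  then show ?thesis
    by (auto intro: power2_le_imp_le ell2_norm_nonneg)
qed

definition basis :: "'v \<Rightarrow> 'v \<Rightarrow> complex" where
  "basis u v = (if v = u then 1 else 0)"

lemma basis_weighted_has_sum: "u \<in> V \<Longrightarrow> ((\<lambda>v. D v * (cmod (basis u v))\<^sup>2) has_sum (D u :: real)) V"
  by (rule has_sum_finite_neutralI[of "{u}"]) (auto simp: basis_def)

lemma basis_ell2: "u \<in> V \<Longrightarrow> basis u \<in> ell2 V"
  using basis_weighted_has_sum[of u V "\<lambda>_. 1"]
  by (auto simp: ell2_def basis_def has_sum_imp_summable)

lemma bounded_operator_cong:
  assumes "\<And>f. f \<in> ell2 V \<Longrightarrow> A f = B f"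
  shows "bounded_operator V A \<longleftrightarrow> bounded_operator V B"
  unfolding bounded_operator_def
  by (intro conj_cong ball_cong ex_cong refl all_cong) (simp_all add: assms ell2_add ell2_cmult)

lemma bounded_operator_funpow:
  assumes A: "bounded_operator V A" and AB: "\<And>f. f \<in> ell2 V \<Longrightarrow> A f = B f" and f: "f \<in> ell2 V"
  shows "(A ^^ n) f \<in> ell2 V \<and> (A ^^ n) f = (B ^^ n) f"
proof (induction n)
  case (Suc n)
  then show ?case
    using A AB[of "(A ^^ n) f"] by (auto simp: bounded_operator_def)
qed (use f in simp)

lemma completely_hyperexpansive_cong:
  assumes "bounded_operator V A" "\<And>f. f \<in> ell2 V \<Longrightarrow> A f = B f"
  shows "completely_hyperexpansive V A \<longleftrightarrow> completely_hyperexpansive V B"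
proof -
  have "(\<lambda>n. (ell2_norm V ((A ^^ n) h))\<^sup>2) = (\<lambda>n. (ell2_norm V ((B ^^ n) h))\<^sup>2)" if "h \<in> ell2 V" for h
    using bounded_operator_funpow[of V A B h, OF assms that] by auto
  then show ?thesis
    unfolding completely_hyperexpansive_def using bounded_operator_cong[of V A B, OF assms(2)] by auto
qed

text \<open>Treats the classical shift and the tree shift at once: the former lives on the natural
  numbers with parent map \<open>n - 1\<close>.\<close>

locale forest =
  fixes V V' :: "'v set" and p :: "'v \<Rightarrow> 'v" and w :: "'v \<Rightarrow> real"
  assumes V'_subset: "V' \<subseteq> V" and parent: "\<And>v. v \<in> V' \<Longrightarrow> p v \<in> V"
begin

definition shift :: "('v \<Rightarrow> complex) \<Rightarrow> 'v \<Rightarrow> complex" where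
  "shift f = (\<lambda>v. if v \<in> V' then complex_of_real (w v) * f (p v) else 0)"

definition children :: "'v \<Rightarrow> 'v set" where
  "children u = {v \<in> V'. p v = u}"

text \<open>A uniform bound for the squared norms of the images of the basis vectors. These images
  are mutually orthogonal, so such a bound is equivalent to boundedness of the shift.\<close>

definition child_bound :: "real \<Rightarrow> bool" where
  "child_bound B \<longleftrightarrow> (\<forall>u\<in>V. (\<lambda>v. (w v)\<^sup>2) summable_on children u \<and> (\<Sum>\<^sub>\<infinity>v\<in>children u. (w v)\<^sup>2) \<le> B)"

text \<open>\<open>shift_moment n u\<close> is the squared norm of the \<open>n\<close>-th power applied to the basis vector at \<open>u\<close>.\<close>

primrec shift_moment :: "nat \<Rightarrow> 'v \<Rightarrow> real" where
  "shift_moment 0 u = 1"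
| "shift_moment (Suc n) u = (\<Sum>\<^sub>\<infinity>v\<in>children u. (w v)\<^sup>2 * shift_moment n v)"

lemma children_subset: "v \<in> children u \<Longrightarrow> v \<in> V"
  using V'_subset by (auto simp: children_def)

lemma shift_moment_nonneg: "0 \<le> shift_moment n u"
  by (induction n arbitrary: u) (auto intro!: infsum_nonneg)

text \<open>Bound and summability have to be proved together: an infinite sum that diverges has the
  value 0, so the recursion for \<open>shift_moment\<close> carries its meaning only along with
  summability.\<close>

lemma shift_moment_summable_le:
  assumes B: "child_bound B" "0 \<le> B" and u: "u \<in> V"
  shows "(\<lambda>v. (w v)\<^sup>2 * shift_moment n v) summable_on children u \<and> shift_moment n u \<le> B ^ n"
  using u
proof (induction n arbitrary: u)
  case 0
  then show ?case
    using B by (simp add: child_bound_def)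
next
  case (Suc n)
  have sm: "(\<lambda>v. (w v)\<^sup>2 * shift_moment m v) summable_on children u"
    if u: "u \<in> V" and le: "\<And>u. u \<in> V \<Longrightarrow> shift_moment m u \<le> B ^ m" for m u
  proof (rule summable_on_comparison_test)
    show "(\<lambda>v. (w v)\<^sup>2 * B ^ m) summable_on children u"
      using B u by (intro summable_on_cmult_left) (simp add: child_bound_def)
  qed (auto intro!: mult_left_mono le children_subset mult_nonneg_nonneg shift_moment_nonneg)
  have le: "shift_moment (Suc n) u \<le> B ^ Suc n" if u: "u \<in> V" for u
  proof -
    have "shift_moment (Suc n) u \<le> (\<Sum>\<^sub>\<infinity>v\<in>children u. (w v)\<^sup>2 * B ^ n)"
      unfolding shift_moment.simps using Suc.IH u B
      by (intro infsum_mono summable_on_cmult_left mult_left_mono) (auto simp: child_bound_def children_subset)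
    also have "\<dots> = (\<Sum>\<^sub>\<infinity>v\<in>children u. (w v)\<^sup>2) * B ^ n"
      by (rule infsum_cmult_left')
    also have "\<dots> \<le> B * B ^ n"
      using B u by (intro mult_right_mono) (auto simp: child_bound_def)
    finally show ?thesis
      by simp
  qed
  show ?case
    using sm[OF Suc.prems le] le[OF Suc.prems] by blast
qed

text \<open>The sets of children partition \<open>V'\<close>, so the sum can be regrouped by
  parents. The weight \<open>D\<close> is there for the iteration: a moment function of one order
  goes in, that of the next order comes out.\<close>

lemma weighted_shift_has_sum:
  assumes D: "\<And>v. 0 \<le> D v"
    and D': "\<And>u. u \<in> V \<Longrightarrow> ((\<lambda>v. (w v)\<^sup>2 * D v) has_sum D' u) (children u)"
    and f: "((\<lambda>u. D' u * (cmod (f u))\<^sup>2) has_sum T) V"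
  shows "((\<lambda>v. D v * (cmod (shift f v))\<^sup>2) has_sum T) V"
proof -
  define h where "h = (\<lambda>(u, v). (w v)\<^sup>2 * D v * (cmod (f u))\<^sup>2)"
  have row: "((\<lambda>v. h (u, v)) has_sum D' u * (cmod (f u))\<^sup>2) (children u)" if "u \<in> V" for u
    unfolding h_def using has_sum_cmult_left[OF D'[OF that]] by simp
  have "h summable_on Sigma V children"
    by (rule summable_on_SigmaI[OF row])
      (use f D in \<open>auto simp: h_def intro: has_sum_imp_summable\<close>)
  from has_sum_SigmaI[OF row f this] have "(h has_sum T) (Sigma V children)" .
  moreover have "Sigma V children = (\<lambda>v. (p v, v)) ` V'"
    using parent by (auto simp: children_def)
  moreover have "inj_on (\<lambda>v. (p v, v)) V'"
    by (auto simp: inj_on_def)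
  ultimately have "((h \<circ> (\<lambda>v. (p v, v))) has_sum T) V'"
    by (simp add: has_sum_reindex)
  also have "?this \<longleftrightarrow> ?thesis"
    using V'_subset
    by (intro has_sum_cong_neutral) (auto simp: shift_def h_def norm_mult power_mult_distrib)
  finally show ?thesis .
qed

text \<open>Orthogonality of the images of distinct basis vectors in summed form. The induction
  peels off the innermost application, replacing \<open>f\<close> by \<open>shift f\<close>.\<close>

lemma shift_funpow_has_sum:
  assumes B: "child_bound B" "0 \<le> B" and f: "f \<in> ell2 V"
  shows "(shift ^^ n) f \<in> ell2 V \<and>
    ((\<lambda>u. shift_moment n u * (cmod (f u))\<^sup>2) has_sum (ell2_norm V ((shift ^^ n) f))\<^sup>2) V"
  using f
proof (induction n arbitrary: f)
  case 0
  then show ?case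
    by (simp add: ell2_has_sum)
next
  case (Suc n)
  have T: "((\<lambda>u. shift_moment (Suc m) u * (cmod (f u))\<^sup>2) has_sum
      (\<Sum>\<^sub>\<infinity>u\<in>V. shift_moment (Suc m) u * (cmod (f u))\<^sup>2)) V" for m
  proof (rule has_sum_infsum, rule summable_on_comparison_test)
    show "(\<lambda>u. B ^ Suc m * (cmod (f u))\<^sup>2) summable_on V"
      using Suc.prems by (intro summable_on_cmult_right) (simp add: ell2_def)
  qed (use shift_moment_summable_le[OF B] shift_moment_nonneg in
      \<open>auto intro!: mult_right_mono simp del: shift_moment.simps power_Suc\<close>)
  have W: "((\<lambda>v. shift_moment m v * (cmod (shift f v))\<^sup>2) has_sum
      (\<Sum>\<^sub>\<infinity>u\<in>V. shift_moment (Suc m) u * (cmod (f u))\<^sup>2)) V" for m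
    by (rule weighted_shift_has_sum[OF _ _ T])
      (use shift_moment_summable_le[OF B] shift_moment_nonneg in auto)
  have "(\<lambda>v. (cmod (shift f v))\<^sup>2) summable_on V"
    using W[of 0] by (auto intro: has_sum_imp_summable)
  then have "shift f \<in> ell2 V"
    using V'_subset by (auto simp: ell2_def shift_def)
  from Suc.IH[OF this] have IH: "(shift ^^ n) (shift f) \<in> ell2 V"
    "((\<lambda>u. shift_moment n u * (cmod (shift f u))\<^sup>2) has_sum (ell2_norm V ((shift ^^ n) (shift f)))\<^sup>2) V"
    by blast+
  have "(\<Sum>\<^sub>\<infinity>u\<in>V. shift_moment (Suc n) u * (cmod (f u))\<^sup>2) = (ell2_norm V ((shift ^^ n) (shift f)))\<^sup>2"
    by (rule has_sum_unique[OF W IH(2)])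
  then show ?case
    using T[of n] IH(1) by (simp only: funpow_Suc_right o_apply)
qed

lemma shift_norm_le:
  assumes B: "child_bound B" "0 \<le> B" and f: "f \<in> ell2 V"
  shows "ell2_norm V (shift f) \<le> sqrt B * ell2_norm V f"
proof -
  have "((\<lambda>u. shift_moment 1 u * (cmod (f u))\<^sup>2) has_sum (ell2_norm V (shift f))\<^sup>2) V"
    using shift_funpow_has_sum[OF B f, of 1] by simp
  moreover have "((\<lambda>u. B * (cmod (f u))\<^sup>2) has_sum B * (ell2_norm V f)\<^sup>2) V"
    by (rule has_sum_cmult_right[OF ell2_has_sum[OF f]])
  ultimately have "(ell2_norm V (shift f))\<^sup>2 \<le> B * (ell2_norm V f)\<^sup>2"
    by (rule has_sum_mono)
      (use shift_moment_summable_le[OF B, of _ 1] in \<open>auto intro!: mult_right_mono simp del: shift_moment.simps\<close>)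
  then have "(ell2_norm V (shift f))\<^sup>2 \<le> (sqrt B * ell2_norm V f)\<^sup>2"
    using B by (simp add: power_mult_distrib)
  then show ?thesis
    by (rule power2_le_imp_le) (use B in \<open>simp add: ell2_norm_nonneg\<close>)
qed

lemma bounded_operator_shift_iff:
  "bounded_operator V shift \<longleftrightarrow> (\<exists>B\<ge>0. child_bound B)"
proof
  assume bounded: "bounded_operator V shift"
  then obtain C where C: "\<And>f. f \<in> ell2 V \<Longrightarrow> ell2_norm V (shift f) \<le> C * ell2_norm V f"
    unfolding bounded_operator_def by blast
  \<comment> \<open>The sum over the children of \<open>u\<close> is the squared norm of the image
    of a unit vector, whence the square.\<close>
  have "child_bound (C\<^sup>2)"
    unfolding child_bound_def
  proof
    fix u assume u: "u \<in> V"
    have mem: "shift (basis u) \<in> ell2 V"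
      using bounded basis_ell2[OF u] by (auto simp: bounded_operator_def)
    have "((\<lambda>v. (cmod (shift (basis u) v))\<^sup>2) has_sum (ell2_norm V (shift (basis u)))\<^sup>2) V"
      by (rule ell2_has_sum[OF mem])
    also have "?this \<longleftrightarrow> ((\<lambda>v. (w v)\<^sup>2) has_sum (ell2_norm V (shift (basis u)))\<^sup>2) (children u)"
      using V'_subset by (intro has_sum_cong_neutral) (auto simp: shift_def children_def basis_def)
    finally have sum: "((\<lambda>v. (w v)\<^sup>2) has_sum (ell2_norm V (shift (basis u)))\<^sup>2) (children u)" .
    have "(ell2_norm V (basis u))\<^sup>2 = 1"
      using has_sum_unique[OF ell2_has_sum[OF basis_ell2[OF u]]] basis_weighted_has_sum[OF u, of "\<lambda>_. 1"]
      by simp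
    then have "ell2_norm V (basis u) = 1"
      using ell2_norm_nonneg[of V "basis u"] by (simp add: power2_eq_1_iff)
    then have "ell2_norm V (shift (basis u)) \<le> C"
      using C[OF basis_ell2[OF u]] by simp
    then have "(ell2_norm V (shift (basis u)))\<^sup>2 \<le> C\<^sup>2"
      by (rule power_mono) (rule ell2_norm_nonneg)
    then show "(\<lambda>v. (w v)\<^sup>2) summable_on children u \<and> (\<Sum>\<^sub>\<infinity>v\<in>children u. (w v)\<^sup>2) \<le> C\<^sup>2"
      using sum by (auto simp: infsumI intro: has_sum_imp_summable)
  qed
  then show "\<exists>B\<ge>0. child_bound B"
    using zero_le_power2 by blast
next
  assume "\<exists>B\<ge>0. child_bound B"
  then obtain B where B: "child_bound B" "0 \<le> B"
    by blast
  show "bounded_operator V shift"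
    unfolding bounded_operator_def
  proof (intro conjI ballI allI exI)
    show "shift f \<in> ell2 V" if "f \<in> ell2 V" for f
      using shift_funpow_has_sum[OF B that, of 1] by simp
    show "ell2_norm V (shift f) \<le> sqrt B * ell2_norm V f" if "f \<in> ell2 V" for f
      by (rule shift_norm_le[OF B that])
  qed (auto simp: shift_def algebra_simps)
qed

lemma shift_moment_basis:
  assumes "bounded_operator V shift" "u \<in> V"
  shows "(ell2_norm V ((shift ^^ n) (basis u)))\<^sup>2 = shift_moment n u"
proof -
  obtain B where "child_bound B" "0 \<le> B"
    using assms(1) by (auto simp: bounded_operator_shift_iff)
  from shift_funpow_has_sum[OF this basis_ell2[OF assms(2)], of n]
  have "((\<lambda>v. shift_moment n v * (cmod (basis u v))\<^sup>2) has_sum (ell2_norm V ((shift ^^ n) (basis u)))\<^sup>2) V"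
    by blast
  then show ?thesis
    using has_sum_unique basis_weighted_has_sum[OF assms(2)] by blast
qed

text \<open>At a general vector \<open>h\<close> the sequence is the combination of the vertex
  sequences with the coefficients \<open>(cmod (h u))\<^sup>2\<close>, so basis vectors suffice as
  tests.\<close>

lemma completely_hyperexpansive_shift_iff:
  assumes "bounded_operator V shift"
  shows "completely_hyperexpansive V shift \<longleftrightarrow> (\<forall>u\<in>V. completely_alternating (\<lambda>n. shift_moment n u))"
proof
  assume "completely_hyperexpansive V shift"
  then show "\<forall>u\<in>V. completely_alternating (\<lambda>n. shift_moment n u)"
    unfolding completely_hyperexpansive_def by (metis (no_types, lifting) basis_ell2 shift_moment_basis ext assms)
next
  assume *: "\<forall>u\<in>V. completely_alternating (\<lambda>n. shift_moment n u)"
  obtain B where B: "child_bound B" "0 \<le> B"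
    using assms by (auto simp: bounded_operator_shift_iff)
  have "completely_alternating (\<lambda>n. (ell2_norm V ((shift ^^ n) h))\<^sup>2)" if h: "h \<in> ell2 V" for h
  proof (rule completely_alternating_has_sum)
    show "completely_alternating (\<lambda>n. (cmod (h u))\<^sup>2 * shift_moment n u)" if "u \<in> V" for u
      by (rule completely_alternating_cmult) (use * that in auto)
    show "((\<lambda>u. (cmod (h u))\<^sup>2 * shift_moment n u) has_sum (ell2_norm V ((shift ^^ n) h))\<^sup>2) V" for n
      using shift_funpow_has_sum[OF B h, of n] by (simp add: mult.commute)
  qed
  then show "completely_hyperexpansive V shift"
    using assms unfolding completely_hyperexpansive_def by blast
qed

end

section \<open>Unilateral weighted shifts\<close>

global_interpretation uni: forest UNIV "{Suc 0..}" "\<lambda>n. n - Suc 0" \<alpha> for \<alpha> :: "nat \<Rightarrow> real"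
  by unfold_locales auto

definition weight_moment :: "(nat \<Rightarrow> real) \<Rightarrow> nat \<Rightarrow> real" where
  "weight_moment \<alpha> n = (\<Prod>j<n. (\<alpha> (Suc j))\<^sup>2)"

lemma weight_moment_0: "weight_moment \<alpha> 0 = 1"
  by (simp add: weight_moment_def)

lemma weight_moment_Suc: "weight_moment \<alpha> (Suc n) = weight_moment \<alpha> n * (\<alpha> (Suc n))\<^sup>2"
  by (simp add: weight_moment_def)

lemma weight_moment_pos: "(\<And>n. 1 \<le> n \<Longrightarrow> 0 < \<alpha> n) \<Longrightarrow> 0 < weight_moment \<alpha> n"
  by (fastforce simp: weight_moment_def intro!: prod_pos zero_less_power)

lemma weight_moment_add:
  "weight_moment \<alpha> (k + n) = weight_moment \<alpha> k * weight_moment (\<lambda>j. \<alpha> (k + j)) n"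
  by (induction n) (auto simp: weight_moment_Suc weight_moment_0)

lemma weight_moment_cong: "(\<And>n. 1 \<le> n \<Longrightarrow> \<alpha> n = \<beta> n) \<Longrightarrow> weight_moment \<alpha> n = weight_moment \<beta> n"
  by (simp add: weight_moment_def)

lemma uni_children: "uni.children k = {Suc k}"
  by (auto simp: uni.children_def)

lemma uni_shift_moment: "uni.shift_moment \<alpha> n k = weight_moment (\<lambda>j. \<alpha> (k + j)) n"
proof (induction n arbitrary: k)
  case (Suc n)
  have "weight_moment (\<lambda>j. \<alpha> (k + j)) (1 + n)
      = (\<alpha> (Suc k))\<^sup>2 * weight_moment (\<lambda>j. \<alpha> (Suc k + j)) n"
    unfolding weight_moment_add by (simp add: weight_moment_Suc weight_moment_0)
  then show ?case
    by (simp add: uni_children Suc.IH)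
qed (simp add: weight_moment_0)

lemma uni_child_bound: "uni.child_bound \<alpha> B \<longleftrightarrow> (\<forall>n\<ge>1. (\<alpha> n)\<^sup>2 \<le> B)"
proof -
  have "(\<forall>n\<ge>1. P n) \<longleftrightarrow> (\<forall>n. P (Suc n))" for P :: "nat \<Rightarrow> bool"
    by (metis Suc_le_D One_nat_def le_add1 plus_1_eq_Suc)
  then show ?thesis
    by (simp add: uni.child_bound_def uni_children)
qed

lemma std_basis_eq_basis: "std_basis n = basis n"
  by (auto simp: std_basis_def basis_def)

text \<open>The definition prescribes \<open>S\<close> on the basis vectors only. Linearity settles
  finitely supported vectors, and boundedness makes the contribution of the tails vanish.\<close>

lemma unilateral_shift_eq:
  assumes S: "unilateral_shift \<alpha> S" and f: "f \<in> ell2 UNIV"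
  shows "S f = uni.shift \<alpha> f"
proof
  fix m
  have bounded: "bounded_operator UNIV S"
    and Sb: "\<And>n. S (std_basis n) = (\<lambda>m. complex_of_real (\<alpha> (n + 1)) * std_basis (n + 1) m)"
    using S by (auto simp: unilateral_shift_def)
  from bounded have add: "\<And>f g. f \<in> ell2 UNIV \<Longrightarrow> g \<in> ell2 UNIV \<Longrightarrow> S (\<lambda>v. f v + g v) = (\<lambda>v. S f v + S g v)"
    and cmult: "\<And>f c. f \<in> ell2 UNIV \<Longrightarrow> S (\<lambda>v. c * f v) = (\<lambda>v. c * S f v)"
    and mem: "\<And>f. f \<in> ell2 UNIV \<Longrightarrow> S f \<in> ell2 UNIV"
    unfolding bounded_operator_def by blast+
  obtain C where C: "\<And>f. f \<in> ell2 UNIV \<Longrightarrow> ell2_norm UNIV (S f) \<le> C * ell2_norm UNIV f"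
    using bounded unfolding bounded_operator_def by blast
  define head where "head N = (\<lambda>v. if v < N then f v else 0)" for N
  define tail where "tail N = (\<lambda>v. if v < N then 0 else f v)" for N
  have basis_mem: "std_basis n \<in> ell2 UNIV" for n :: nat
    by (simp add: std_basis_eq_basis basis_ell2)
  have head_Suc: "head (Suc N) = (\<lambda>v. head N v + f N * std_basis N v)" for N
    by (auto simp: head_def std_basis_def fun_eq_iff less_Suc_eq)
  have head: "head N \<in> ell2 UNIV \<and> S (head N) = uni.shift \<alpha> (head N)" for N
  proof (induction N)
    case 0
    have "head 0 = (\<lambda>v. 0 * std_basis 0 v)"
      by (auto simp: head_def)
    then show ?case
      using cmult[OF basis_mem, of 0 0] ell2_cmult[OF basis_mem, of 0 0]
      by (auto simp: uni.shift_def)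
  next
    case (Suc N)
    have "S (head (Suc N)) = (\<lambda>v. S (head N) v + f N * S (std_basis N) v)"
      unfolding head_Suc using Suc basis_mem by (simp add: add cmult ell2_cmult)
    also have "\<dots> = uni.shift \<alpha> (head (Suc N))"
      unfolding Sb using Suc
      by (auto simp: fun_eq_iff head_Suc uni.shift_def std_basis_def algebra_simps)
    finally show ?case
      using Suc basis_mem by (auto simp: head_Suc intro!: ell2_add ell2_cmult)
  qed
  have tail_sum: "((\<lambda>v. (cmod (tail N v))\<^sup>2) has_sum
      ((ell2_norm UNIV f)\<^sup>2 + - (\<Sum>v<N. (cmod (f v))\<^sup>2))) UNIV" for N
  proof -
    have "((\<lambda>v. (cmod (head N v))\<^sup>2) has_sum (\<Sum>v<N. (cmod (f v))\<^sup>2)) UNIV"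
      by (rule has_sum_finite_neutralI[of "{..<N}"]) (auto simp: head_def)
    then have "((\<lambda>v. (cmod (f v))\<^sup>2 + - (cmod (head N v))\<^sup>2) has_sum
      ((ell2_norm UNIV f)\<^sup>2 + - (\<Sum>v<N. (cmod (f v))\<^sup>2))) UNIV"
      by (intro has_sum_add has_sum_uminusI ell2_has_sum f)
    moreover have "(\<lambda>v. (cmod (f v))\<^sup>2 + - (cmod (head N v))\<^sup>2) = (\<lambda>v. (cmod (tail N v))\<^sup>2)"
      by (auto simp: head_def tail_def)
    ultimately show ?thesis
      by simp
  qed
  have tail: "tail N \<in> ell2 UNIV" for N
    using tail_sum[of N] by (auto simp: ell2_def intro: has_sum_imp_summable)
  have tail_norm: "ell2_norm UNIV (tail N) = sqrt ((ell2_norm UNIV f)\<^sup>2 + - (\<Sum>v<N. (cmod (f v))\<^sup>2))" for N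
    using tail_sum[of N] by (simp add: ell2_norm_def infsumI)
  have "(\<lambda>v. (cmod (f v))\<^sup>2) sums (ell2_norm UNIV f)\<^sup>2"
    by (rule has_sum_imp_sums[OF ell2_has_sum[OF f]])
  then have "(\<lambda>N. ell2_norm UNIV (tail N)) \<longlonglongrightarrow> sqrt ((ell2_norm UNIV f)\<^sup>2 + - (ell2_norm UNIV f)\<^sup>2)"
    unfolding tail_norm sums_def by (intro tendsto_intros)
  then have lim: "(\<lambda>N. C * ell2_norm UNIV (tail N)) \<longlonglongrightarrow> 0"
    by (auto intro: tendsto_mult_right_zero)
  \<comment> \<open>Coordinate \<open>m\<close> of the shift looks at coordinate
    \<open>m - 1\<close> of \<open>f\<close> at most, so for \<open>m < N\<close> the two images
    differ there by the value of \<open>S (tail N)\<close> alone.\<close>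
  have "cmod (S f m - uni.shift \<alpha> f m) \<le> C * ell2_norm UNIV (tail N)" if "m < N" for N
  proof -
    have "f = (\<lambda>v. head N v + tail N v)"
      by (auto simp: head_def tail_def)
    then have "S f = (\<lambda>v. S (head N) v + S (tail N) v)"
      using add head tail by metis
    moreover have "uni.shift \<alpha> (head N) m = uni.shift \<alpha> f m"
      using that by (auto simp: uni.shift_def head_def)
    ultimately have "S f m - uni.shift \<alpha> f m = S (tail N) m"
      using head by simp
    then have "cmod (S f m - uni.shift \<alpha> f m) \<le> ell2_norm UNIV (S (tail N))"
      using cmod_le_ell2_norm[OF mem[OF tail]] by simp
    also have "\<dots> \<le> C * ell2_norm UNIV (tail N)"
      by (rule C[OF tail])
    finally show ?thesis .
  qed
  then have "cmod (S f m - uni.shift \<alpha> f m) \<le> 0"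
    by (intro LIMSEQ_le_const[OF lim]) (metis Suc_le_eq)
  then show "S f m = uni.shift \<alpha> f m"
    by simp
qed

lemma unilateral_shift_bounded:
  assumes "unilateral_shift \<alpha> S"
  shows "bounded_operator UNIV (uni.shift \<alpha>)"
  using assms unilateral_shift_eq[OF assms] bounded_operator_cong[of UNIV S "uni.shift \<alpha>"]
  by (auto simp: unilateral_shift_def)

lemma unilateral_shift_uni:
  assumes "\<And>n. 1 \<le> n \<Longrightarrow> (\<alpha> n)\<^sup>2 \<le> B"
  shows "unilateral_shift \<alpha> (uni.shift \<alpha>)"
proof -
  have "0 \<le> B"
    using assms[of 1] zero_le_power2[of "\<alpha> 1"] by linarith
  then have "bounded_operator UNIV (uni.shift \<alpha>)"
    unfolding uni.bounded_operator_shift_iff uni_child_bound using assms by auto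
  then show ?thesis
    by (auto simp: unilateral_shift_def uni.shift_def std_basis_def fun_eq_iff)
qed

text \<open>The sequence at the basis vector \<open>k\<close> is that at 0, moved by
  \<open>k\<close> places and divided by the positive number
  \<open>weight_moment \<alpha> k\<close>. One vector therefore decides.\<close>

lemma unilateral_shift_completely_hyperexpansive_iff:
  assumes S: "unilateral_shift \<alpha> S" and pos: "\<And>n. 1 \<le> n \<Longrightarrow> 0 < \<alpha> n"
  shows "completely_hyperexpansive UNIV S \<longleftrightarrow> completely_alternating (weight_moment \<alpha>)"
proof -
  have "completely_hyperexpansive UNIV S \<longleftrightarrow> completely_hyperexpansive UNIV (uni.shift \<alpha>)"
    using S unilateral_shift_eq[OF S] by (intro completely_hyperexpansive_cong) (auto simp: unilateral_shift_def)
  also have "\<dots> \<longleftrightarrow> (\<forall>k. completely_alternating (\<lambda>n. weight_moment (\<lambda>j. \<alpha> (k + j)) n))"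
    using uni.completely_hyperexpansive_shift_iff[OF unilateral_shift_bounded[OF S]]
    by (simp add: uni_shift_moment)
  also have "\<dots> \<longleftrightarrow> completely_alternating (weight_moment \<alpha>)"
  proof
    assume *: "completely_alternating (weight_moment \<alpha>)"
    show "\<forall>k. completely_alternating (\<lambda>n. weight_moment (\<lambda>j. \<alpha> (k + j)) n)"
    proof
      fix k
      have "(\<lambda>n. weight_moment (\<lambda>j. \<alpha> (k + j)) n) = (\<lambda>n. 1 / weight_moment \<alpha> k * weight_moment \<alpha> (k + n))"
        using weight_moment_pos[of \<alpha> k, OF pos] by (simp add: weight_moment_add)
      then show "completely_alternating (\<lambda>n. weight_moment (\<lambda>j. \<alpha> (k + j)) n)"
        using weight_moment_pos[of \<alpha> k, OF pos] *
        by (simp only:) (intro completely_alternating_cmult completely_alternating_shift, auto)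
    qed
  next
    assume "\<forall>k. completely_alternating (\<lambda>n. weight_moment (\<lambda>j. \<alpha> (k + j)) n)"
    from spec[OF this, of 0] show "completely_alternating (weight_moment \<alpha>)"
      by simp
  qed
  finally show ?thesis .
qed

lemma shift_representing_measure_eq:
  assumes "unilateral_shift \<alpha> S"
  shows "shift_representing_measure S = representing_measure (weight_moment \<alpha>)"
proof -
  have "(ell2_norm UNIV ((S ^^ n) (std_basis 0)))\<^sup>2 = weight_moment \<alpha> n" for n
    using bounded_operator_funpow[of UNIV S "uni.shift \<alpha>" "basis 0" n] assms unilateral_shift_eq[OF assms]
      uni.shift_moment_basis[OF unilateral_shift_bounded[OF assms], of 0 n]
    by (simp add: std_basis_eq_basis basis_ell2 uni_shift_moment unilateral_shift_def)
  then show ?thesis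
    by (simp add: shift_representing_measure_def)
qed

lemma op_norm_unilateral_shift_le:
  assumes S: "unilateral_shift \<alpha> S" and B: "\<And>n. 1 \<le> n \<Longrightarrow> (\<alpha> n)\<^sup>2 \<le> B"
  shows "op_norm UNIV S \<le> sqrt B"
  unfolding op_norm_def
proof (rule cSUP_least)
  have "(\<lambda>_. 0) \<in> {f \<in> ell2 UNIV. ell2_norm UNIV f \<le> 1}"
    by (auto simp: ell2_def ell2_norm_def)
  then show "{f \<in> ell2 UNIV. ell2_norm UNIV f \<le> 1} \<noteq> {}"
    by blast
  fix f :: "nat \<Rightarrow> complex"
  assume f: "f \<in> {f \<in> ell2 UNIV. ell2_norm UNIV f \<le> 1}"
  have B0: "0 \<le> B"
    using B[of 1] zero_le_power2[of "\<alpha> 1"] by linarith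
  have "ell2_norm UNIV (S f) \<le> sqrt B * ell2_norm UNIV f"
    using f B B0 unilateral_shift_eq[OF S] uni.shift_norm_le[of \<alpha> B f] by (auto simp: uni_child_bound)
  also have "\<dots> \<le> sqrt B * 1"
    using f B0 by (intro mult_left_mono) auto
  finally show "ell2_norm UNIV (S f) \<le> sqrt B"
    by simp
qed

lemma weight_le_op_norm:
  assumes S: "unilateral_shift \<alpha> S" and n: "1 \<le> n"
  shows "\<bar>\<alpha> n\<bar> \<le> op_norm UNIV S"
proof -
  obtain B where B: "0 \<le> B" "uni.child_bound \<alpha> B"
    using unilateral_shift_bounded[OF S] by (auto simp: uni.bounded_operator_shift_iff)
  \<comment> \<open>\<open>op_norm\<close> is a supremum of reals, so boundedness above has to be
    known before a member can be compared with it.\<close>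
  have bdd: "bdd_above ((\<lambda>f. ell2_norm UNIV (S f)) ` {f \<in> ell2 UNIV. ell2_norm UNIV f \<le> 1})"
  proof (rule bdd_aboveI2)
    fix f :: "nat \<Rightarrow> complex"
    assume f: "f \<in> {f \<in> ell2 UNIV. ell2_norm UNIV f \<le> 1}"
    have "ell2_norm UNIV (S f) \<le> sqrt B * ell2_norm UNIV f"
      using f B unilateral_shift_eq[OF S] uni.shift_norm_le[of \<alpha> B f] by auto
    also have "\<dots> \<le> sqrt B * 1"
      using f B by (intro mult_left_mono) auto
    finally show "ell2_norm UNIV (S f) \<le> sqrt B"
      by simp
  qed
  have mem: "(basis (n - 1) :: nat \<Rightarrow> complex) \<in> ell2 UNIV"
    by (simp add: basis_ell2)
  have norm: "ell2_norm UNIV (basis k :: nat \<Rightarrow> complex) = 1" for k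
    using basis_weighted_has_sum[of k UNIV "\<lambda>_. 1"] by (simp add: ell2_norm_def infsumI)
  have "(ell2_norm UNIV (S (basis (n - 1))))\<^sup>2 = (\<alpha> n)\<^sup>2"
    using uni.shift_moment_basis[OF unilateral_shift_bounded[OF S], of "n - 1" 1] n
    unfolding unilateral_shift_eq[OF S mem] by (simp add: uni_children)
  then have "\<bar>\<alpha> n\<bar> = ell2_norm UNIV (S (basis (n - 1)))"
    using ell2_norm_nonneg[of UNIV "S (basis (n - 1))"] by (metis abs_of_nonneg power2_eq_iff_nonneg abs_ge_zero power2_abs)
  also have "\<dots> \<le> op_norm UNIV S"
    unfolding op_norm_def by (rule cSUP_upper[OF _ bdd]) (use mem norm in auto)
  finally show ?thesis .
qed

section \<open>Backward extensions of shifts in terms of moment sequences\<close>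

text \<open>Increments decrease while terms increase, so the relative increment is largest at the
  start. This gives boundedness of every shift whose weights are built from such a sequence.\<close>

lemma completely_alternating_ratio_le:
  assumes a: "completely_alternating a" and pos: "0 < a 0"
  shows "a (Suc n) / a n \<le> a 1 / a 0"
proof -
  have "a (Suc (Suc k)) - a (Suc k) \<le> a (Suc k) - a k" for k
    using a[unfolded completely_alternating_iff_bdiff, rule_format, of 1 k] by simp
  then have "a (Suc n) - a n \<le> a (Suc 0) - a 0"
    by (rule lift_Suc_antimono_le[of "\<lambda>k. a (Suc k) - a k"]) simp
  moreover have "a 0 \<le> a n" "a 0 \<le> a 1"
    by (auto intro: completely_alternating_mono[OF a])
  ultimately have "(a (Suc n) - a n) / a n \<le> (a 1 - a 0) / a 0"
    using pos by (intro frac_le) auto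
  then show ?thesis
    using pos \<open>a 0 \<le> a n\<close> by (simp add: diff_divide_distrib)
qed

lemma completely_alternating_pos:
  "completely_alternating a \<Longrightarrow> 0 < a 0 \<Longrightarrow> 0 < a n"
  using completely_alternating_mono[of a 0 n] by simp

text \<open>Moments are products of squared weights, and weights are roots of quotients of moments.
  The moments of the extended shift start at 1; dividing by their term \<open>k\<close> makes them
  continue as \<open>weight_moment \<alpha>\<close>, so 1 as first term is traded for an arbitrary
  positive one.\<close>

lemma has_ch_backward_extension_iff:
  assumes pos: "\<And>n. 1 \<le> n \<Longrightarrow> 0 < \<alpha> n"
  shows "has_ch_backward_extension k \<alpha> \<longleftrightarrow>
    (\<exists>a. completely_alternating a \<and> 0 < a 0 \<and> (\<forall>n. a (k + n) = weight_moment \<alpha> n))"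
proof
  assume "has_ch_backward_extension k \<alpha>"
  then obtain \<beta> T where \<beta>: "\<forall>n\<ge>1. \<beta> (int n) = \<alpha> n" "\<forall>j\<in>{- int k + 1..0}. \<beta> j > 0"
    and T: "unilateral_shift (\<lambda>n. \<beta> (- int k + int n)) T" "completely_hyperexpansive UNIV T"
    by (auto simp: has_ch_backward_extension_def)
  define \<gamma> where "\<gamma> n = \<beta> (- int k + int n)" for n
  have \<gamma>_pos: "0 < \<gamma> n" if "1 \<le> n" for n
  proof (cases "n \<le> k")
    case True
    then show ?thesis
      using \<beta>(2) that by (simp add: \<gamma>_def)
  next
    case False
    then have "\<gamma> n = \<beta> (int (n - k))"
      by (simp add: \<gamma>_def)
    also have "\<dots> = \<alpha> (n - k)"
      by (rule \<beta>(1)[rule_format]) (use False in simp)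
    finally show ?thesis
      using pos[of "n - k"] False by simp
  qed
  have ca: "completely_alternating (weight_moment \<gamma>)"
    using T \<gamma>_pos unilateral_shift_completely_hyperexpansive_iff[of \<gamma> T] by (simp add: \<gamma>_def[abs_def])
  have split: "weight_moment \<gamma> (k + n) = weight_moment \<gamma> k * weight_moment \<alpha> n" for n
    unfolding weight_moment_add using \<beta>(1) by (simp add: \<gamma>_def cong: weight_moment_cong)
  have wpos: "0 < weight_moment \<gamma> n" for n
    by (rule weight_moment_pos[OF \<gamma>_pos])
  show "\<exists>a. completely_alternating a \<and> 0 < a 0 \<and> (\<forall>n. a (k + n) = weight_moment \<alpha> n)"
  proof (intro exI conjI allI)
    show "completely_alternating (\<lambda>n. 1 / weight_moment \<gamma> k * weight_moment \<gamma> n)"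
      by (intro completely_alternating_cmult ca) (simp add: less_imp_le wpos)
    show "0 < 1 / weight_moment \<gamma> k * weight_moment \<gamma> 0"
      by (simp add: wpos)
    show "1 / weight_moment \<gamma> k * weight_moment \<gamma> (k + n) = weight_moment \<alpha> n" for n
      using wpos[of k] by (simp add: split)
  qed
next
  assume "\<exists>a. completely_alternating a \<and> 0 < a 0 \<and> (\<forall>n. a (k + n) = weight_moment \<alpha> n)"
  then obtain a where a: "completely_alternating a" "0 < a 0" and ext: "\<And>n. a (k + n) = weight_moment \<alpha> n"
    by blast
  have a_pos: "0 < a n" for n
    by (rule completely_alternating_pos[OF a])
  \<comment> \<open>The weight with index \<open>j <= 0\<close> leads from term
    \<open>k + j - 1\<close> of \<open>a\<close> to term \<open>k + j\<close>; for
    \<open>j >= - k + 1\<close> both indices are natural numbers.\<close>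
  define \<beta> where "\<beta> j = (if 1 \<le> j then \<alpha> (nat j)
      else sqrt (a (nat (int k + j)) / a (nat (int k + j - 1))))" for j
  define \<gamma> where "\<gamma> n = \<beta> (- int k + int n)" for n
  have \<gamma>_sq: "(\<gamma> (Suc n))\<^sup>2 = a (Suc n) / a n" for n
  proof (cases "n < k")
    case True
    then have "\<gamma> (Suc n) = sqrt (a (Suc n) / a n)"
      by (simp add: \<gamma>_def \<beta>_def nat_add_distrib)
    then show ?thesis
      using a_pos by (simp add: less_imp_le)
  next
    case False
    then obtain m where m: "n = k + m"
      by (metis le_iff_add not_less)
    then have "(\<gamma> (Suc n))\<^sup>2 = weight_moment \<alpha> (Suc m) / weight_moment \<alpha> m"
      using weight_moment_pos[of \<alpha> m, OF pos] by (simp add: \<gamma>_def \<beta>_def weight_moment_Suc nat_add_distrib)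
    then show ?thesis
      using ext[of m] ext[of "Suc m"] m by simp
  qed
  have \<gamma>_pos: "0 < \<beta> j" if "- int k + 1 \<le> j" for j
    using that pos a_pos by (auto simp: \<beta>_def)
  have wm: "weight_moment \<gamma> n = 1 / a 0 * a n" for n
    using a_pos[THEN less_imp_neq] by (induction n) (auto simp: weight_moment_0 weight_moment_Suc \<gamma>_sq)
  have bound: "(\<gamma> n)\<^sup>2 \<le> a 1 / a 0" if "1 \<le> n" for n
    using that \<gamma>_sq[of "n - 1"] completely_alternating_ratio_le[OF a, of "n - 1"] by simp
  have T: "unilateral_shift \<gamma> (uni.shift \<gamma>)"
    by (rule unilateral_shift_uni[OF bound])
  have "completely_alternating (weight_moment \<gamma>)"
    unfolding wm using a by (intro completely_alternating_cmult) auto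
  then have ch: "completely_hyperexpansive UNIV (uni.shift \<gamma>)"
    using unilateral_shift_completely_hyperexpansive_iff[OF T] \<gamma>_pos by (simp add: \<gamma>_def)
  show "has_ch_backward_extension k \<alpha>"
    unfolding has_ch_backward_extension_def
  proof (intro exI conjI ballI allI impI)
    show "unilateral_shift (\<lambda>n. \<beta> (- int k + int n)) (uni.shift \<gamma>)"
      using T by (simp add: \<gamma>_def[abs_def])
    show "completely_hyperexpansive UNIV (uni.shift \<gamma>)"
      by (rule ch)
    show "\<beta> (int n) = \<alpha> n" if "1 \<le> n" for n
      using that by (simp add: \<beta>_def)
    show "0 < \<beta> j" if "j \<in> {- int k + 1..0}" for j
      using that by (intro \<gamma>_pos) simp
  qed
qed

section \<open>Weighted shifts on the directed tree\<close>

lemma tree_vertices_eq: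
  "tree_vertices \<eta> \<kappa> = (\<lambda>k. Trunk (- int k)) ` {..\<kappa>} \<union> {Branch i j | i j. i \<in> J \<eta> \<and> 1 \<le> j}"
  by (force simp: tree_vertices_def J_def image_iff not_less_eq_eq)

lemma nonroot_vertices_eq:
  "nonroot_vertices \<eta> \<kappa> = (\<lambda>k. Trunk (- int k)) ` {..<\<kappa>} \<union> {Branch i j | i j. i \<in> J \<eta> \<and> 1 \<le> j}"
  by (force simp: nonroot_vertices_def tree_vertices_eq tree_root_def)

lemma tree_parent_trunk:
  assumes "k < \<kappa>"
  shows "tree_parent \<eta> \<kappa> (Trunk (- int k)) = Trunk (- int (Suc k))"
  unfolding tree_parent_def
proof (rule the_equality)
  have "(Trunk (- int (Suc k)), Trunk (- int (Suc k) + 1)) \<in> tree_edges \<eta> \<kappa>"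
    using assms unfolding tree_edges_def by (force simp: J_def)
  then show "(Trunk (- int (Suc k)), Trunk (- int k)) \<in> tree_edges \<eta> \<kappa>"
    by simp
qed (auto simp: tree_edges_def)

lemma tree_parent_branch_1:
  assumes "i \<in> J \<eta>"
  shows "tree_parent \<eta> \<kappa> (Branch i (Suc 0)) = Trunk 0"
  unfolding tree_parent_def
  by (rule the_equality) (use assms in \<open>auto simp: tree_edges_def\<close>)

lemma tree_parent_branch_Suc:
  assumes "i \<in> J \<eta>" "1 \<le> j"
  shows "tree_parent \<eta> \<kappa> (Branch i (Suc j)) = Branch i j"
  unfolding tree_parent_def
  by (rule the_equality) (use assms in \<open>auto simp: tree_edges_def\<close>)

lemma nonroot_cases:
  assumes "v \<in> nonroot_vertices \<eta> \<kappa>"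
  obtains (trunk) k where "k < \<kappa>" "v = Trunk (- int k)" "tree_parent \<eta> \<kappa> v = Trunk (- int (Suc k))"
  | (branch_1) i where "i \<in> J \<eta>" "v = Branch i (Suc 0)" "tree_parent \<eta> \<kappa> v = Trunk 0"
  | (branch_Suc) i j where "i \<in> J \<eta>" "1 \<le> j" "v = Branch i (Suc j)" "tree_parent \<eta> \<kappa> v = Branch i j"
proof -
  consider k where "k < \<kappa>" "v = Trunk (- int k)" | i j where "i \<in> J \<eta>" "1 \<le> j" "v = Branch i j"
    using assms unfolding nonroot_vertices_eq by blast
  then show thesis
  proof cases
    case 1
    then show ?thesis
      using trunk tree_parent_trunk by blast
  next
    case 2
    show ?thesis
    proof (cases "j = 1")
      case True
      then show ?thesis
        using 2 branch_1 tree_parent_branch_1 by simp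
    next
      case False
      then obtain j' where "j = Suc j'" "1 \<le> j'"
        using 2 by (cases j) auto
      then show ?thesis
        using 2 branch_Suc tree_parent_branch_Suc by blast
    qed
  qed
qed

lemma branch_nonroot: "i \<in> J \<eta> \<Longrightarrow> 1 \<le> j \<Longrightarrow> Branch i j \<in> nonroot_vertices \<eta> \<kappa>"
  by (auto simp: nonroot_vertices_eq)

lemma trunk_nonroot: "k < \<kappa> \<Longrightarrow> Trunk (- int k) \<in> nonroot_vertices \<eta> \<kappa>"
  by (auto simp: nonroot_vertices_eq)

global_interpretation tree: forest "tree_vertices \<eta> \<kappa>" "nonroot_vertices \<eta> \<kappa>" "tree_parent \<eta> \<kappa>" w
  for \<eta> \<kappa> w
proof
  show "nonroot_vertices \<eta> \<kappa> \<subseteq> tree_vertices \<eta> \<kappa>"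
    by (auto simp: nonroot_vertices_def)
  show "tree_parent \<eta> \<kappa> v \<in> tree_vertices \<eta> \<kappa>" if "v \<in> nonroot_vertices \<eta> \<kappa>" for v
    using that by (cases rule: nonroot_cases) (auto simp: tree_vertices_eq image_iff intro: bexI[of _ "Suc _"])
qed

lemma tree_shift_eq: "tree_shift \<eta> \<kappa> w = tree.shift \<eta> \<kappa> w"
  by (auto simp: tree_shift_def tree.shift_def fun_eq_iff)

lemma tree_children_trunk:
  assumes "k < \<kappa>"
  shows "tree.children \<eta> \<kappa> (Trunk (- int (Suc k))) = {Trunk (- int k)}"
proof -
  have "v = Trunk (- int k)" if "v \<in> tree.children \<eta> \<kappa> (Trunk (- int (Suc k)))" for v
  proof -
    have v: "v \<in> nonroot_vertices \<eta> \<kappa>" and p: "tree_parent \<eta> \<kappa> v = Trunk (- int (Suc k))"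
      using that by (auto simp: tree.children_def)
    from v show ?thesis
      by (cases rule: nonroot_cases) (use p in auto)
  qed
  moreover have "Trunk (- int k) \<in> tree.children \<eta> \<kappa> (Trunk (- int (Suc k)))"
    using assms unfolding tree.children_def by (simp add: trunk_nonroot tree_parent_trunk)
  ultimately show ?thesis
    by blast
qed

lemma tree_children_0: "tree.children \<eta> \<kappa> (Trunk 0) = (\<lambda>i. Branch i (Suc 0)) ` J \<eta>"
proof -
  have "v \<in> (\<lambda>i. Branch i (Suc 0)) ` J \<eta>" if "v \<in> tree.children \<eta> \<kappa> (Trunk 0)" for v
  proof -
    have v: "v \<in> nonroot_vertices \<eta> \<kappa>" and p: "tree_parent \<eta> \<kappa> v = Trunk 0"
      using that by (auto simp: tree.children_def)
    from v show ?thesis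
      by (cases rule: nonroot_cases) (use p in auto)
  qed
  then show ?thesis
    by (auto simp: tree.children_def branch_nonroot tree_parent_branch_1)
qed

lemma tree_children_branch:
  assumes "i \<in> J \<eta>" "1 \<le> j"
  shows "tree.children \<eta> \<kappa> (Branch i j) = {Branch i (Suc j)}"
proof -
  have "v = Branch i (Suc j)" if "v \<in> tree.children \<eta> \<kappa> (Branch i j)" for v
  proof -
    have v: "v \<in> nonroot_vertices \<eta> \<kappa>" and p: "tree_parent \<eta> \<kappa> v = Branch i j"
      using that by (auto simp: tree.children_def)
    from v show ?thesis
      by (cases rule: nonroot_cases) (use p in auto)
  qed
  then show ?thesis
    using assms by (auto simp: tree.children_def branch_nonroot tree_parent_branch_Suc)
qed

lemma tree_moment_branch:
  assumes "i \<in> J \<eta>" "1 \<le> j"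
  shows "tree.shift_moment \<eta> \<kappa> w n (Branch i j) = weight_moment (\<lambda>l. w (Branch i (j + l))) n"
  using assms(2)
proof (induction n arbitrary: j)
  case (Suc n)
  have "weight_moment (\<lambda>l. w (Branch i (j + l))) (1 + n)
      = (w (Branch i (Suc j)))\<^sup>2 * weight_moment (\<lambda>l. w (Branch i (Suc j + l))) n"
    unfolding weight_moment_add by (simp add: weight_moment_Suc weight_moment_0)
  then show ?case
    using Suc by (simp add: tree_children_branch[OF assms(1)])
qed (simp add: weight_moment_0)

lemma tree_moment_trunk:
  "k < \<kappa> \<Longrightarrow> tree.shift_moment \<eta> \<kappa> w (Suc n) (Trunk (- int (Suc k)))
    = (w (Trunk (- int k)))\<^sup>2 * tree.shift_moment \<eta> \<kappa> w n (Trunk (- int k))"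
  using tree_children_trunk[of k \<kappa> \<eta>] by simp

lemma tree_moment_0:
  "tree.shift_moment \<eta> \<kappa> w (Suc n) (Trunk 0)
    = (\<Sum>\<^sub>\<infinity>i\<in>J \<eta>. (w (Branch i (Suc 0)))\<^sup>2 * weight_moment (\<lambda>l. w (Branch i (Suc l))) n)"
proof -
  have "tree.shift_moment \<eta> \<kappa> w (Suc n) (Trunk 0)
      = (\<Sum>\<^sub>\<infinity>i\<in>J \<eta>. (w (Branch i (Suc 0)))\<^sup>2 * tree.shift_moment \<eta> \<kappa> w n (Branch i (Suc 0)))"
    by (simp add: tree_children_0 infsum_reindex inj_on_def o_def)
  also have "\<dots> = (\<Sum>\<^sub>\<infinity>i\<in>J \<eta>. (w (Branch i (Suc 0)))\<^sup>2 * weight_moment (\<lambda>l. w (Branch i (Suc l))) n)"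
    by (rule infsum_cong) (simp add: tree_moment_branch)
  finally show ?thesis .
qed

section \<open>Moments at the root and the choice of the weights\<close>

text \<open>The trunk does not fork, so \<open>\<kappa>\<close> steps from the root lead to a
  multiple of the basis vector at 0, and one more step reaches all branches. Thus
  \<open>\<mu> i\<close> is the product of the squared trunk weights and of the squared first weight
  of branch \<open>i\<close>.\<close>

lemma tree_shift_imp_branches:
  assumes w: "\<And>v. v \<in> nonroot_vertices \<eta> \<kappa> \<Longrightarrow> 0 < w v"
    and ch: "completely_hyperexpansive (tree_vertices \<eta> \<kappa>) (tree_shift \<eta> \<kappa> w)"
    and \<alpha>: "\<And>i n. i \<in> J \<eta> \<Longrightarrow> 1 \<le> n \<Longrightarrow> \<alpha> i n = w (Branch i (n + 1))"
  shows "\<exists>B. \<forall>i\<in>J \<eta>. \<forall>n\<ge>1. (\<alpha> i n)\<^sup>2 \<le> B"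
    and "i \<in> J \<eta> \<Longrightarrow> completely_alternating (weight_moment (\<alpha> i))"
    and "\<exists>a \<mu>. completely_alternating a \<and> 0 < a 0 \<and> (\<forall>i\<in>J \<eta>. 0 < \<mu> i) \<and>
      (\<forall>n. ((\<lambda>i. \<mu> i * weight_moment (\<alpha> i) n) has_sum a (\<kappa> + 1 + n)) (J \<eta>))"
proof -
  have bounded: "bounded_operator (tree_vertices \<eta> \<kappa>) (tree.shift \<eta> \<kappa> w)"
    using ch unfolding completely_hyperexpansive_def tree_shift_eq by blast
  have ca: "completely_alternating (\<lambda>n. tree.shift_moment \<eta> \<kappa> w n u)" if "u \<in> tree_vertices \<eta> \<kappa>" for u
    using ch that unfolding tree_shift_eq tree.completely_hyperexpansive_shift_iff[OF bounded] by blast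
  obtain B where B: "tree.child_bound \<eta> \<kappa> w B" "0 \<le> B"
    using bounded unfolding tree.bounded_operator_shift_iff by blast
  have branch: "Branch i j \<in> tree_vertices \<eta> \<kappa>" if "i \<in> J \<eta>" "1 \<le> j" for i j
    using that by (auto simp: tree_vertices_eq)
  have "(\<alpha> i n)\<^sup>2 \<le> B" if "i \<in> J \<eta>" "1 \<le> n" for i n
    using B(1)[unfolded tree.child_bound_def, rule_format, OF branch[OF that]] \<alpha>[OF that]
    by (simp add: tree_children_branch[OF that])
  then show "\<exists>B. \<forall>i\<in>J \<eta>. \<forall>n\<ge>1. (\<alpha> i n)\<^sup>2 \<le> B"
    by blast
  have wm: "weight_moment (\<lambda>l. w (Branch i (Suc l))) n = weight_moment (\<alpha> i) n" if "i \<in> J \<eta>" for i n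
    by (rule weight_moment_cong) (simp add: \<alpha>[OF that])
  show "completely_alternating (weight_moment (\<alpha> i))" if "i \<in> J \<eta>" for i
    using ca[OF branch[OF that, of 1]] tree_moment_branch[OF that, of 1 \<kappa> w] wm[OF that] by simp
  have "\<exists>c>0. \<forall>n. tree.shift_moment \<eta> \<kappa> w (k + n) (Trunk (- int k)) = c * tree.shift_moment \<eta> \<kappa> w n (Trunk 0)"
    if "k \<le> \<kappa>" for k
    using that
  proof (induction k)
    case (Suc k)
    then obtain c where c: "0 < c"
      "\<And>n. tree.shift_moment \<eta> \<kappa> w (k + n) (Trunk (- int k)) = c * tree.shift_moment \<eta> \<kappa> w n (Trunk 0)"
      by auto
    have "0 < w (Trunk (- int k))"
      using Suc.prems by (intro w trunk_nonroot) simp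
    then show ?case
      using c Suc.prems
      by (intro exI[of _ "(w (Trunk (- int k)))\<^sup>2 * c"])
        (auto simp only: add_Suc tree_moment_trunk Suc_le_eq mult.assoc zero_less_mult_iff zero_less_power)
  qed (auto intro: exI[of _ 1])
  from this[of \<kappa>] obtain c where c: "0 < c"
    "\<And>n. tree.shift_moment \<eta> \<kappa> w (\<kappa> + n) (Trunk (- int \<kappa>)) = c * tree.shift_moment \<eta> \<kappa> w n (Trunk 0)"
    by blast
  define a where "a n = tree.shift_moment \<eta> \<kappa> w n (Trunk (- int \<kappa>))" for n
  define \<mu> where "\<mu> i = c * (w (Branch i (Suc 0)))\<^sup>2" for i
  have "completely_alternating a"
    unfolding a_def[abs_def] by (rule ca) (simp add: tree_vertices_eq)
  moreover have "0 < a 0"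
    by (simp add: a_def)
  moreover have "\<forall>i\<in>J \<eta>. 0 < \<mu> i"
    using c(1) w[OF branch_nonroot] by (auto simp: \<mu>_def intro!: mult_pos_pos zero_less_power)
  moreover have "((\<lambda>i. \<mu> i * weight_moment (\<alpha> i) n) has_sum a (\<kappa> + 1 + n)) (J \<eta>)" for n
  proof -
    have "Trunk 0 \<in> tree_vertices \<eta> \<kappa>"
      by (auto simp: tree_vertices_eq image_iff intro: bexI[of _ 0])
    from tree.shift_moment_summable_le[OF B this, of n]
    have "(\<lambda>v. (w v)\<^sup>2 * tree.shift_moment \<eta> \<kappa> w n v) summable_on (\<lambda>i. Branch i (Suc 0)) ` J \<eta>"
      by (simp add: tree_children_0)
    then have "(\<lambda>i. (w (Branch i (Suc 0)))\<^sup>2 * tree.shift_moment \<eta> \<kappa> w n (Branch i (Suc 0))) summable_on J \<eta>"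
      by (subst (asm) summable_on_reindex) (auto simp: inj_on_def o_def)
    also have "?this \<longleftrightarrow> (\<lambda>i. (w (Branch i (Suc 0)))\<^sup>2 * weight_moment (\<lambda>l. w (Branch i (Suc l))) n) summable_on J \<eta>"
      by (rule summable_on_cong) (simp add: tree_moment_branch)
    finally have "((\<lambda>i. c * ((w (Branch i (Suc 0)))\<^sup>2 * weight_moment (\<lambda>l. w (Branch i (Suc l))) n))
        has_sum c * tree.shift_moment \<eta> \<kappa> w (Suc n) (Trunk 0)) (J \<eta>)"
      unfolding tree_moment_0 by (intro has_sum_cmult_right has_sum_infsum)
    also have "c * tree.shift_moment \<eta> \<kappa> w (Suc n) (Trunk 0) = a (\<kappa> + 1 + n)"
      using c(2)[of "Suc n"] by (simp only: a_def) simp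
    finally show ?thesis
      by (rule has_sum_cong[THEN iffD1, rotated]) (simp add: \<mu>_def wm mult.assoc)
  qed
  ultimately show "\<exists>a \<mu>. completely_alternating a \<and> 0 < a 0 \<and> (\<forall>i\<in>J \<eta>. 0 < \<mu> i) \<and>
      (\<forall>n. ((\<lambda>i. \<mu> i * weight_moment (\<alpha> i) n) has_sum a (\<kappa> + 1 + n)) (J \<eta>))"
    by blast
qed

text \<open>Read backwards, \<open>a\<close> dictates the weights left open by
  \<open>\<alpha>\<close>. At the trunk vertex \<open>-k\<close> the moments become the part of
  \<open>a\<close> from \<open>\<kappa> - k\<close> on, divided by its first term, and such parts
  are again completely alternating.\<close>

lemma tree_shift_exists:
  assumes a: "completely_alternating a" "0 < a 0"
    and \<mu>: "\<And>i. i \<in> J \<eta> \<Longrightarrow> 0 < \<mu> i"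
    and sum: "\<And>n. ((\<lambda>i. \<mu> i * weight_moment (\<alpha> i) n) has_sum a (\<kappa> + 1 + n)) (J \<eta>)"
    and pos: "\<And>i n. i \<in> J \<eta> \<Longrightarrow> 1 \<le> n \<Longrightarrow> 0 < \<alpha> i n"
    and bound: "\<And>i n. i \<in> J \<eta> \<Longrightarrow> 1 \<le> n \<Longrightarrow> (\<alpha> i n)\<^sup>2 \<le> B"
    and ca: "\<And>i. i \<in> J \<eta> \<Longrightarrow> completely_alternating (weight_moment (\<alpha> i))"
  shows "\<exists>w. (\<forall>v\<in>nonroot_vertices \<eta> \<kappa>. 0 < w v) \<and>
    bounded_operator (tree_vertices \<eta> \<kappa>) (tree_shift \<eta> \<kappa> w) \<and>
    completely_hyperexpansive (tree_vertices \<eta> \<kappa>) (tree_shift \<eta> \<kappa> w) \<and>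
    (\<forall>i\<in>J \<eta>. \<forall>n\<ge>1. \<alpha> i n = w (Branch i (n + 1)))"
proof -
  have a_pos: "0 < a n" for n
    by (rule completely_alternating_pos[OF a])
  \<comment> \<open>The weight at the trunk vertex \<open>-k\<close> leads from term
    \<open>\<kappa> - k - 1\<close> of \<open>a\<close> to term \<open>\<kappa> - k\<close>. The
    squared first branch weights split \<open>a (\<kappa> + 1) / a \<kappa>\<close> in the
    proportions \<open>\<mu> i\<close>.\<close>
  define w where "w v = (case v of
      Trunk z \<Rightarrow> sqrt (a (nat (int \<kappa> + z)) / a (nat (int \<kappa> + z - 1)))
    | Branch i j \<Rightarrow> if j = 1 then sqrt (\<mu> i / a \<kappa>) else \<alpha> i (j - 1))" for v
  have w_trunk: "(w (Trunk (- int k)))\<^sup>2 = a (\<kappa> - k) / a (\<kappa> - Suc k)" if "k < \<kappa>" for k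
  proof -
    have "nat (int \<kappa> + - int k) = \<kappa> - k" "nat (int \<kappa> + - int k - 1) = \<kappa> - Suc k"
      using that by auto
    then show ?thesis
      using a_pos by (simp add: w_def less_imp_le)
  qed
  have w_branch_1: "(w (Branch i (Suc 0)))\<^sup>2 = \<mu> i / a \<kappa>" if "i \<in> J \<eta>" for i
    using \<mu>[OF that] a_pos[of \<kappa>] by (simp add: w_def)
  have w_branch: "w (Branch i (Suc n)) = \<alpha> i n" if "1 \<le> n" for i n
    using that by (simp add: w_def)
  have wm: "weight_moment (\<lambda>l. w (Branch i (Suc (k + l)))) n = weight_moment (\<lambda>l. \<alpha> i (k + l)) n" for i k n
    by (rule weight_moment_cong) (simp add: w_branch)
  have w_pos: "0 < w v" if "v \<in> nonroot_vertices \<eta> \<kappa>" for v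
    using that
  proof (cases rule: nonroot_cases)
    case (branch_Suc i j)
    then show ?thesis
      using pos by (simp add: w_branch)
  qed (use \<mu> a_pos in \<open>auto simp: w_def\<close>)
  have moment_0: "tree.shift_moment \<eta> \<kappa> w n (Trunk 0) = a (\<kappa> + n) / a \<kappa>" for n
  proof (cases n)
    case 0
    then show ?thesis
      using a_pos[of \<kappa>] by simp
  next
    case (Suc m)
    have "tree.shift_moment \<eta> \<kappa> w (Suc m) (Trunk 0)
        = (\<Sum>\<^sub>\<infinity>i\<in>J \<eta>. 1 / a \<kappa> * (\<mu> i * weight_moment (\<alpha> i) m))"
      unfolding tree_moment_0 using wm[of _ 0]
      by (intro infsum_cong) (simp add: w_branch_1)
    also have "\<dots> = 1 / a \<kappa> * a (\<kappa> + 1 + m)"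
      by (intro infsumI has_sum_cmult_right sum)
    finally show ?thesis
      using Suc by simp
  qed
  have moment_trunk: "tree.shift_moment \<eta> \<kappa> w n (Trunk (- int k)) = a (\<kappa> - k + n) / a (\<kappa> - k)"
    if "k \<le> \<kappa>" for n k
    using that
  proof (induction k arbitrary: n)
    case 0
    then show ?case
      using moment_0 by simp
  next
    case (Suc k)
    show ?case
    proof (cases n)
      case 0
      then show ?thesis
        using a_pos[of "\<kappa> - Suc k"] by simp
    next
      case (Suc m)
      have "tree.shift_moment \<eta> \<kappa> w (Suc m) (Trunk (- int (Suc k)))
          = a (\<kappa> - k) / a (\<kappa> - Suc k) * (a (\<kappa> - k + m) / a (\<kappa> - k))"
        using Suc.prems Suc.IH by (subst tree_moment_trunk) (simp_all add: w_trunk)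
      also have "\<dots> = a (\<kappa> - Suc k + Suc m) / a (\<kappa> - Suc k)"
        using a_pos[of "\<kappa> - k"] Suc.prems by (simp add: Suc_diff_Suc)
      finally show ?thesis
        unfolding Suc .
    qed
  qed
  \<comment> \<open>On a branch the child sum is one squared weight, bounded by \<open>B\<close>; on
    the trunk it is a quotient of consecutive terms of \<open>a\<close>, the forking vertex
    included.\<close>
  have "tree.child_bound \<eta> \<kappa> w (max B (a 1 / a 0))"
    unfolding tree.child_bound_def
  proof
    fix u assume "u \<in> tree_vertices \<eta> \<kappa>"
    then consider k where "k \<le> \<kappa>" "u = Trunk (- int k)" | i j where "i \<in> J \<eta>" "1 \<le> j" "u = Branch i j"
      unfolding tree_vertices_eq by auto
    then consider "u = Trunk 0" | k where "k < \<kappa>" "u = Trunk (- int (Suc k))"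
      | i j where "i \<in> J \<eta>" "1 \<le> j" "u = Branch i j"
    proof cases
      case (1 k)
      then show thesis
        using that(1,2) by (cases k) auto
    qed (use that(3) in blast)
    then show "(\<lambda>v. (w v)\<^sup>2) summable_on tree.children \<eta> \<kappa> u \<and>
        (\<Sum>\<^sub>\<infinity>v\<in>tree.children \<eta> \<kappa> u. (w v)\<^sup>2) \<le> max B (a 1 / a 0)"
    proof cases
      case 1
      \<comment> \<open>Moments of order 0 are 1, so the case \<open>n = 0\<close> sums the
        coefficients \<open>\<mu> i\<close> to \<open>a (\<kappa> + 1)\<close>.\<close>
      have "((\<lambda>i. 1 / a \<kappa> * (\<mu> i * weight_moment (\<alpha> i) 0)) has_sum 1 / a \<kappa> * a (\<kappa> + 1 + 0)) (J \<eta>)"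
        by (intro has_sum_cmult_right sum)
      then have "((\<lambda>i. (w (Branch i (Suc 0)))\<^sup>2) has_sum a (Suc \<kappa>) / a \<kappa>) (J \<eta>)"
        by (subst has_sum_cong[OF w_branch_1]) (simp_all add: weight_moment_0)
      then have "((\<lambda>v. (w v)\<^sup>2) has_sum a (Suc \<kappa>) / a \<kappa>) (tree.children \<eta> \<kappa> u)"
        unfolding 1 tree_children_0 by (subst has_sum_reindex) (auto simp: inj_on_def o_def)
      then show ?thesis
        using completely_alternating_ratio_le[OF a, of \<kappa>]
        by (auto simp: infsumI has_sum_imp_summable)
    next
      case 2
      then have "Suc (\<kappa> - Suc k) = \<kappa> - k"
        by simp
      then show ?thesis
        using 2 completely_alternating_ratio_le[OF a, of "\<kappa> - Suc k"]
        by (simp only: tree_children_trunk) (simp add: w_trunk)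
    next
      case 3
      then show ?thesis
        using bound[of i j] by (simp add: tree_children_branch w_branch)
    qed
  qed
  moreover have "0 \<le> max B (a 1 / a 0)"
    using a_pos[of 0] a_pos[of 1] by (simp add: le_max_iff_disj)
  ultimately have bounded: "bounded_operator (tree_vertices \<eta> \<kappa>) (tree.shift \<eta> \<kappa> w)"
    unfolding tree.bounded_operator_shift_iff by blast
  have "completely_alternating (\<lambda>n. tree.shift_moment \<eta> \<kappa> w n u)" if "u \<in> tree_vertices \<eta> \<kappa>" for u
  proof -
    from that consider k where "k \<le> \<kappa>" "u = Trunk (- int k)" | i j where "i \<in> J \<eta>" "1 \<le> j" "u = Branch i j"
      unfolding tree_vertices_eq by auto
    then show ?thesis
    proof cases
      case 1
      have "completely_alternating (\<lambda>n. 1 / a (\<kappa> - k) * a (\<kappa> - k + n))"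
        by (intro completely_alternating_cmult completely_alternating_shift a) (simp add: a_pos less_imp_le)
      then show ?thesis
        using 1 moment_trunk by simp
    next
      case 2
      then obtain k where k: "j = Suc k"
        by (cases j) auto
      have *: "0 < weight_moment (\<alpha> i) k"
        using pos 2 by (intro weight_moment_pos) auto
      have "completely_alternating (\<lambda>n. 1 / weight_moment (\<alpha> i) k * weight_moment (\<alpha> i) (k + n))"
        using * by (intro completely_alternating_cmult completely_alternating_shift ca 2) simp
      then show ?thesis
        using 2 * k wm[of i k] by (simp add: tree_moment_branch weight_moment_add)
    qed
  qed
  then have "completely_hyperexpansive (tree_vertices \<eta> \<kappa>) (tree.shift \<eta> \<kappa> w)"
    unfolding tree.completely_hyperexpansive_shift_iff[OF bounded] by blast
  then show ?thesis
    using bounded w_pos w_branch unfolding tree_shift_eq by (intro exI[of _ w]) auto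
qed

text \<open>The sequence \<open>A i\<^sub>0\<close> starts with a positive term; small weights on the other ones keep it so.\<close>

lemma positive_combination_exists:
  fixes A :: "nat \<Rightarrow> nat \<Rightarrow> real"
  assumes i0: "i\<^sub>0 \<in> I" and ca: "\<And>i. i \<in> I \<Longrightarrow> completely_alternating (A i)"
    and pos: "0 < A i\<^sub>0 0" and upper: "\<And>i n. i \<in> I \<Longrightarrow> A i n \<le> K n"
  obtains a \<mu> where "completely_alternating a" "0 < a 0" "\<And>i. i \<in> I \<Longrightarrow> 0 < \<mu> i"
    "\<And>n. ((\<lambda>i. \<mu> i * A i n) has_sum a n) I"
proof -
  \<comment> \<open>The other sequences will contribute at least \<open>- 2 * \<epsilon>\<close> in
    total, against \<open>4 * \<epsilon>\<close> from \<open>i\<^sub>0\<close>.\<close>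
  define \<epsilon> where "\<epsilon> = A i\<^sub>0 0 / 4"
  have \<epsilon>: "0 < \<epsilon>"
    using pos by (simp add: \<epsilon>_def)
  \<comment> \<open>The denominator gives
    \<open>\<mu> i * A i 0 >= - \<epsilon> * (1/2) ^ i\<close>, and the powers of \<open>1/2\<close>
    add up to at most 2.\<close>
  define \<mu> where "\<mu> i = (if i = i\<^sub>0 then 1 else \<epsilon> * (1/2) ^ i / (1 + \<bar>A i 0\<bar>))" for i
  have \<mu>: "0 < \<mu> i" for i
    using \<epsilon> by (auto simp: \<mu>_def intro!: divide_pos_pos mult_pos_pos)
  have geom: "((\<lambda>i. (1/2) ^ i) has_sum (2::real)) (UNIV :: nat set)"
    using geometric_sums[of "1/2 :: real"] by (intro sums_nonneg_imp_has_sum) auto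
  have geom_I: "(\<lambda>i. (1/2::real) ^ i) summable_on I"
    using summable_on_subset_banach[OF has_sum_imp_summable[OF geom]] by auto
  have geom_le: "(\<Sum>\<^sub>\<infinity>i\<in>I. (1/2::real) ^ i) \<le> 2"
    using infsum_mono2[OF geom_I has_sum_imp_summable[OF geom]] infsumI[OF geom] by auto
  have summable: "(\<lambda>i. \<mu> i * A i n) summable_on I" for n
  proof (rule abs_summable_summable, rule summable_on_comparison_test)
    \<comment> \<open>The first summand serves the indices other than \<open>i\<^sub>0\<close>; in
      the second, \<open>2 ^ i\<^sub>0\<close> cancels the geometric factor at
      \<open>i\<^sub>0\<close>.\<close>
    define L where "L = \<epsilon> * (1 + \<bar>K n\<bar>) + 2 ^ i\<^sub>0 * \<bar>A i\<^sub>0 n\<bar>"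
    show "(\<lambda>i. (1/2) ^ i * L) summable_on I"
      by (rule summable_on_cmult_left[OF geom_I])
    fix i assume i: "i \<in> I"
    show "norm (\<mu> i * A i n) \<le> (1/2) ^ i * L"
    proof (cases "i = i\<^sub>0")
      case True
      have "\<bar>A i\<^sub>0 n\<bar> = (1/2) ^ i * (2 ^ i\<^sub>0 * \<bar>A i\<^sub>0 n\<bar>)"
        using True by (simp add: power_one_over)
      also have "\<dots> \<le> (1/2) ^ i * L"
        using \<epsilon> by (intro mult_left_mono) (auto simp: L_def)
      finally show ?thesis
        using True by (simp add: \<mu>_def)
    next
      case False
      have "A i 0 \<le> A i n"
        by (rule completely_alternating_mono[OF ca[OF i]]) simp
      then have "\<bar>A i n\<bar> \<le> \<bar>A i 0\<bar> + \<bar>K n\<bar>"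
        using upper[OF i, of n] by linarith
      also have "\<dots> \<le> (1 + \<bar>A i 0\<bar>) * (1 + \<bar>K n\<bar>)"
        by (simp add: algebra_simps)
      finally have "\<bar>A i n\<bar> / (1 + \<bar>A i 0\<bar>) \<le> 1 + \<bar>K n\<bar>"
        by (subst pos_divide_le_eq) (simp_all add: mult.commute)
      then have "(1/2) ^ i * \<epsilon> * (\<bar>A i n\<bar> / (1 + \<bar>A i 0\<bar>)) \<le> (1/2) ^ i * \<epsilon> * (1 + \<bar>K n\<bar>)"
        using \<epsilon> by (intro mult_left_mono) auto
      also have "\<dots> \<le> (1/2) ^ i * L"
        unfolding mult.assoc by (intro mult_left_mono) (auto simp: L_def)
      finally show ?thesis
        using False \<epsilon> by (simp add: \<mu>_def abs_mult mult.commute)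
    qed
  qed auto
  define a where "a n = (\<Sum>\<^sub>\<infinity>i\<in>I. \<mu> i * A i n)" for n
  have sum: "((\<lambda>i. \<mu> i * A i n) has_sum a n) I" for n
    unfolding a_def by (rule has_sum_infsum[OF summable])
  have "completely_alternating a"
    by (rule completely_alternating_has_sum[OF _ sum])
      (use ca \<mu> in \<open>auto intro!: completely_alternating_cmult simp: less_imp_le\<close>)
  moreover have "0 < a 0"
  proof -
    have "((\<lambda>i. if i = i\<^sub>0 then 4 * \<epsilon> else 0) has_sum 4 * \<epsilon>) I"
      by (rule has_sum_finite_neutralI[of "{i\<^sub>0}"]) (use i0 in auto)
    moreover have "((\<lambda>i. - (\<epsilon> * (1/2) ^ i)) has_sum - (\<epsilon> * (\<Sum>\<^sub>\<infinity>i\<in>I. (1/2::real) ^ i))) I"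
      by (intro has_sum_uminusI has_sum_cmult_right has_sum_infsum geom_I)
    ultimately have "((\<lambda>i. (if i = i\<^sub>0 then 4 * \<epsilon> else 0) + - (\<epsilon> * (1/2) ^ i))
        has_sum (4 * \<epsilon> + - (\<epsilon> * (\<Sum>\<^sub>\<infinity>i\<in>I. (1/2::real) ^ i)))) I"
      by (rule has_sum_add)
    then have "4 * \<epsilon> + - (\<epsilon> * (\<Sum>\<^sub>\<infinity>i\<in>I. (1/2::real) ^ i)) \<le> a 0"
    proof (rule has_sum_mono[OF _ sum[of 0]])
      fix i assume "i \<in> I"
      show "(if i = i\<^sub>0 then 4 * \<epsilon> else 0) + - (\<epsilon> * (1/2) ^ i) \<le> \<mu> i * A i 0"
      proof (cases "i = i\<^sub>0")
        case True
        have "0 \<le> \<epsilon> * (1/2) ^ i"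
          using \<epsilon> by simp
        moreover have "\<mu> i * A i 0 = 4 * \<epsilon>"
          using True by (simp add: \<mu>_def \<epsilon>_def)
        ultimately show ?thesis
          using True by simp
      next
        case False
        have "- 1 \<le> A i 0 / (1 + \<bar>A i 0\<bar>)"
          by (subst pos_le_divide_eq) auto
        then have "\<epsilon> * (1/2) ^ i * - 1 \<le> \<epsilon> * (1/2) ^ i * (A i 0 / (1 + \<bar>A i 0\<bar>))"
          using \<epsilon> by (intro mult_left_mono) auto
        then show ?thesis
          using False by (simp add: \<mu>_def)
      qed
    qed
    moreover have "\<epsilon> * (\<Sum>\<^sub>\<infinity>i\<in>I. (1/2::real) ^ i) \<le> \<epsilon> * 2"
      using \<epsilon> geom_le by (intro mult_left_mono) auto
    ultimately show ?thesis
      using \<epsilon> by linarith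
  qed
  ultimately show ?thesis
    using \<mu> sum by (intro that)
qed

section \<open>Necessity for a combination of sequences\<close>

lemma nn_integral_recip_power_le:
  assumes "1 \<le> k"
  shows "(\<integral>\<^sup>+ s. 1 / ennreal (s ^ k) \<partial>\<tau>) \<le> (\<integral>\<^sup>+ s. (\<Sum>j=1..k. 1 / ennreal (s ^ j)) \<partial>\<tau>)"
proof (rule nn_integral_mono)
  show "1 / ennreal (s ^ k) \<le> (\<Sum>j=1..k. 1 / ennreal (s ^ j))" for s
    using assms by (intro member_le_sum) auto
qed

text \<open>The coefficients sum to \<open>a k\<close>, because every \<open>b i\<close> starts with
  1. Were all the integrals \<open>X i\<close> at least 1, their partial sums would stay below
  \<open>a k - a 0\<close>, which is impossible for \<open>0 < a 0\<close>. A branch with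
  \<open>X i < 1\<close> has an extension that starts at \<open>1 - X i\<close>.\<close>

lemma backward_extension_of_combination:
  assumes a: "completely_alternating a" "0 < a 0"
    and \<mu>: "\<And>i. i \<in> I \<Longrightarrow> 0 < \<mu> i"
    and sum: "\<And>n. ((\<lambda>i. \<mu> i * b i n) has_sum a (k + n)) I"
    and b: "\<And>i. i \<in> I \<Longrightarrow> completely_alternating (b i)" "\<And>i. i \<in> I \<Longrightarrow> b i 0 = 1"
    and k: "1 \<le> k"
  shows "\<forall>i\<in>I. (\<integral>\<^sup>+ s. 1 / ennreal (s ^ k) \<partial>representing_measure (b i)) < \<infinity>"
    and "\<exists>i\<in>I. \<exists>a. completely_alternating a \<and> 0 < a 0 \<and> (\<forall>n. a (k + n) = b i n)"
proof -
  define X where "X i = (\<integral>\<^sup>+ s. (\<Sum>j=1..k. 1 / ennreal (s ^ j)) \<partial>representing_measure (b i))" for i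
  have rep: "represents (representing_measure (b i)) (b i)" if "i \<in> I" for i
    by (rule represents_representing_measure[OF b(1)[OF that]])
  have bound: "(\<Sum>i\<in>F. ennreal (\<mu> i) * X i) \<le> ennreal (a k - a 0)" if "finite F" "F \<subseteq> I" for F
    unfolding X_def
    by (rule backward_extension_bound[OF a(1) rep _ sum that]) (simp_all add: \<mu> less_imp_le)
  have X_fin: "X i < \<infinity>" if "i \<in> I" for i
  proof -
    have "ennreal (\<mu> i) * X i < \<infinity>"
      using bound[of "{i}"] that by (auto intro: le_less_trans)
    then show ?thesis
      using \<mu>[OF that] by (auto simp: ennreal_mult_less_top)
  qed
  then show fin: "\<forall>i\<in>I. (\<integral>\<^sup>+ s. 1 / ennreal (s ^ k) \<partial>representing_measure (b i)) < \<infinity>"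
    unfolding X_def using nn_integral_recip_power_le[OF k] le_less_trans by blast
  have "\<exists>i\<in>I. X i < 1"
  proof (rule ccontr)
    assume "\<not> (\<exists>i\<in>I. X i < 1)"
    then have X1: "1 \<le> X i" if "i \<in> I" for i
      using that by (auto simp: not_less)
    have partial: "(\<Sum>i\<in>F. \<mu> i) \<le> a k - a 0" if F: "finite F" "F \<subseteq> I" for F
    proof -
      have "ennreal (\<Sum>i\<in>F. \<mu> i) = (\<Sum>i\<in>F. ennreal (\<mu> i) * 1)"
        using F \<mu> by (subst sum_ennreal[symmetric]) (auto simp: less_imp_le subset_eq)
      also have "\<dots> \<le> (\<Sum>i\<in>F. ennreal (\<mu> i) * X i)"
        using F X1 by (intro sum_mono mult_left_mono) auto
      also have "\<dots> \<le> ennreal (a k - a 0)"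
        by (rule bound[OF F])
      finally show ?thesis
        using completely_alternating_mono[OF a(1), of 0 k] by simp
    qed
    have "(\<mu> has_sum a k) I"
      using sum[of 0] has_sum_cong[of I "\<lambda>i. \<mu> i * b i 0" \<mu>] b(2) by simp
    from has_sum_le_finite_sums[OF this partial] show False
      using a(2) by simp
  qed
  then obtain i where i: "i \<in> I" "X i < 1"
    by blast
  obtain a' where a': "completely_alternating a'" "\<And>n. a' (k + n) = b i n" "ennreal (b i 0 - a' 0) = X i"
    using backward_extension_exists[OF rep[OF i(1)], of k] fin i(1) unfolding X_def by blast
  \<comment> \<open>Argued by contradiction because \<open>ennreal\<close> sends negative numbers to
    0, so its argument has to be compared with 1 first.\<close>
  have "0 < a' 0"
  proof (rule ccontr)
    assume "\<not> 0 < a' 0"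
    then have "ennreal 1 \<le> ennreal (b i 0 - a' 0)"
      using b(2)[OF i(1)] by (intro ennreal_leI) simp
    then show False
      using a'(3) i(2) by simp
  qed
  then show "\<exists>i\<in>I. \<exists>a. completely_alternating a \<and> 0 < a 0 \<and> (\<forall>n. a (k + n) = b i n)"
    using i a' by blast
qed

theorem proposition7p4p4:
  fixes \<eta> :: enat and \<kappa> :: nat
    and S :: "nat \<Rightarrow> (nat \<Rightarrow> complex) \<Rightarrow> (nat \<Rightarrow> complex)"
    and \<alpha> :: "nat \<Rightarrow> nat \<Rightarrow> real"
  assumes "\<eta> \<ge> 2"
    and "\<And>i n. i \<in> J \<eta> \<Longrightarrow> n \<ge> 1 \<Longrightarrow> \<alpha> i n > 0"
    and "\<And>i. i \<in> J \<eta> \<Longrightarrow> unilateral_shift (\<alpha> i) (S i)"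
  shows "(\<exists>w :: vertex \<Rightarrow> real.
            (\<forall>v\<in>nonroot_vertices \<eta> \<kappa>. w v > 0) \<and>
            bounded_operator (tree_vertices \<eta> \<kappa>) (tree_shift \<eta> \<kappa> w) \<and>
            completely_hyperexpansive (tree_vertices \<eta> \<kappa>) (tree_shift \<eta> \<kappa> w) \<and>
            (\<forall>i\<in>J \<eta>. \<forall>n\<ge>1. \<alpha> i n = w (Branch i (n + 1))))
     \<longleftrightarrow>
         (\<forall>i\<in>J \<eta>. completely_hyperexpansive UNIV (S i) \<and>
            (\<integral>\<^sup>+ s. 1 / ennreal (s ^ (\<kappa> + 1)) \<partial>shift_representing_measure (S i)) < \<infinity>) \<and>
         (\<exists>i\<^sub>0\<in>J \<eta>. has_ch_backward_extension (\<kappa> + 1) (\<alpha> i\<^sub>0)) \<and>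
         bdd_above ((\<lambda>i. op_norm UNIV (S i)) ` J \<eta>)"
    (is "?tree \<longleftrightarrow> ?branches")
proof -
  have pos: "0 < \<alpha> i n" if "i \<in> J \<eta>" "1 \<le> n" for i n
    by (rule assms(2)[OF that])
  have S: "unilateral_shift (\<alpha> i) (S i)" if "i \<in> J \<eta>" for i
    by (rule assms(3)[OF that])
  have ch_iff: "completely_hyperexpansive UNIV (S i) \<longleftrightarrow> completely_alternating (weight_moment (\<alpha> i))"
    if "i \<in> J \<eta>" for i
    by (rule unilateral_shift_completely_hyperexpansive_iff[OF S[OF that] pos[OF that]])
  have measure_eq: "shift_representing_measure (S i) = representing_measure (weight_moment (\<alpha> i))"
    if "i \<in> J \<eta>" for i
    by (rule shift_representing_measure_eq[OF S[OF that]])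
  have extension_iff: "has_ch_backward_extension k (\<alpha> i) \<longleftrightarrow>
      (\<exists>a. completely_alternating a \<and> 0 < a 0 \<and> (\<forall>n. a (k + n) = weight_moment (\<alpha> i) n))"
    if "i \<in> J \<eta>" for i k
    by (rule has_ch_backward_extension_iff[OF pos[OF that]])
  show ?thesis
  proof
    assume ?tree
    then obtain w where w: "\<And>v. v \<in> nonroot_vertices \<eta> \<kappa> \<Longrightarrow> 0 < w v"
      "completely_hyperexpansive (tree_vertices \<eta> \<kappa>) (tree_shift \<eta> \<kappa> w)"
      "\<And>i n. i \<in> J \<eta> \<Longrightarrow> 1 \<le> n \<Longrightarrow> \<alpha> i n = w (Branch i (n + 1))"
      by blast
    note branches = tree_shift_imp_branches[OF w]
    obtain a \<mu> where a: "completely_alternating a" "0 < a 0" and \<mu>: "\<And>i. i \<in> J \<eta> \<Longrightarrow> 0 < \<mu> i"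
      and sum: "\<And>n. ((\<lambda>i. \<mu> i * weight_moment (\<alpha> i) n) has_sum a (\<kappa> + 1 + n)) (J \<eta>)"
      using branches(3) by blast
    note extension = backward_extension_of_combination[OF a \<mu> sum branches(2) weight_moment_0]
    obtain B where "\<And>i n. i \<in> J \<eta> \<Longrightarrow> 1 \<le> n \<Longrightarrow> (\<alpha> i n)\<^sup>2 \<le> B"
      using branches(1) by blast
    then have "op_norm UNIV (S i) \<le> sqrt B" if "i \<in> J \<eta>" for i
      using op_norm_unilateral_shift_le[OF S[OF that]] that by blast
    then have "bdd_above ((\<lambda>i. op_norm UNIV (S i)) ` J \<eta>)"
      by (rule bdd_aboveI2)
    then show ?branches
      using extension branches(2) ch_iff measure_eq extension_iff by simp
  next
    assume branches: ?branches
    then have ca: "completely_alternating (weight_moment (\<alpha> i))" if "i \<in> J \<eta>" for i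
      using ch_iff that by blast
    obtain M where "\<And>i. i \<in> J \<eta> \<Longrightarrow> op_norm UNIV (S i) \<le> M"
      using branches unfolding bdd_above_def by blast
    then have M: "\<bar>\<alpha> i n\<bar> \<le> M" if "i \<in> J \<eta>" "1 \<le> n" for i n
      using weight_le_op_norm[OF S] that order_trans by blast
    have bound: "(\<alpha> i n)\<^sup>2 \<le> M\<^sup>2" if "i \<in> J \<eta>" "1 \<le> n" for i n
      using power_mono[OF M[OF that], of 2] by simp
    have weight_moment_le: "weight_moment (\<alpha> i) n \<le> (M\<^sup>2) ^ n" if "i \<in> J \<eta>" for i n
      unfolding weight_moment_def using prod_mono[of "{..<n}" "\<lambda>j. (\<alpha> i (Suc j))\<^sup>2" "\<lambda>_. M\<^sup>2"] bound[OF that]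
      by simp
    obtain i\<^sub>0 a\<^sub>0 where i0: "i\<^sub>0 \<in> J \<eta>" and a0: "completely_alternating a\<^sub>0" "0 < a\<^sub>0 0"
      "\<And>n. a\<^sub>0 (\<kappa> + 1 + n) = weight_moment (\<alpha> i\<^sub>0) n"
      using branches extension_iff by blast
    \<comment> \<open>For \<open>i\<^sub>0\<close> the given extension with positive start is kept;
      any extension will do for the other branches, whose first terms may be negative.\<close>
    have "\<exists>a. completely_alternating a \<and> (\<forall>n. a (\<kappa> + 1 + n) = weight_moment (\<alpha> i) n) \<and> (i = i\<^sub>0 \<longrightarrow> a = a\<^sub>0)"
      if i: "i \<in> J \<eta>" for i
    proof (cases "i = i\<^sub>0")
      case False
      have "(\<integral>\<^sup>+ s. 1 / ennreal (s ^ (\<kappa> + 1)) \<partial>representing_measure (weight_moment (\<alpha> i))) < \<infinity>"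
        using branches i measure_eq by metis
      from backward_extension_exists[OF represents_representing_measure[OF ca[OF i]] this]
      show ?thesis
        using False by metis
    qed (use a0 in auto)
    then obtain A where A: "\<And>i. i \<in> J \<eta> \<Longrightarrow> completely_alternating (A i)"
      "\<And>i n. i \<in> J \<eta> \<Longrightarrow> A i (\<kappa> + 1 + n) = weight_moment (\<alpha> i) n" "A i\<^sub>0 = a\<^sub>0"
      using i0 by metis
    \<comment> \<open>An extension is increasing, so its term \<open>n\<close> is at most term
      \<open>\<kappa> + 1 + n\<close>, a product of \<open>n\<close> squared weights. The bound is
      uniform in \<open>i\<close>, as summability of the combination requires.\<close>
    have upper: "A i n \<le> (M\<^sup>2) ^ n" if "i \<in> J \<eta>" for i n
    proof -
      have "A i n \<le> A i (\<kappa> + 1 + n)"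
        by (rule completely_alternating_mono[OF A(1)[OF that]]) simp
      also have "\<dots> \<le> (M\<^sup>2) ^ n"
        unfolding A(2)[OF that] by (rule weight_moment_le[OF that])
      finally show ?thesis .
    qed
    have A_pos: "0 < A i\<^sub>0 0"
      using A(3) a0(2) by simp
    obtain a \<mu> where a: "completely_alternating a" "0 < a 0" and \<mu>: "\<And>i. i \<in> J \<eta> \<Longrightarrow> 0 < \<mu> i"
      and sum: "\<And>n. ((\<lambda>i. \<mu> i * A i n) has_sum a n) (J \<eta>)"
      by (rule positive_combination_exists[of i\<^sub>0 "J \<eta>" A "\<lambda>n. (M\<^sup>2) ^ n", OF i0 A(1) A_pos upper]) blast+
    have "((\<lambda>i. \<mu> i * weight_moment (\<alpha> i) n) has_sum a (\<kappa> + 1 + n)) (J \<eta>)" for n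
      using sum[of "\<kappa> + 1 + n"] by (rule has_sum_cong[THEN iffD1, rotated]) (simp only: A(2))
    from tree_shift_exists[OF a \<mu> this pos bound ca] show ?tree .
  qed
qed

end
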